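(* Let $\{\pi_k\}_{k\ge0}$ and $\{V^{\pi_k}\}_{k\ge0}$ be the policy and value sequences generated by PMD with mirror map $h(p)=\sum_a\psi(p(a))$ and a constant step size $\eta>0$. If $\sum_{k\ge0}\|V^*-V^{\pi_k}\|_\infty<\infty$, then PMD converges in the policy domain, i.e. $\pi_\infty:=\lim_{k\to\infty}\pi_k$ exists and $\pi_\infty\in\Pi^*$. Furthermore: (i) $\pi_\infty(a'|s)=0$ for all $s\in\mathcal S$ and $a'\notin\mathcal A_s^*$; (ii) $\pi_\infty(a^*|s)=1$ for all $s\in\mathcal S_{=1}$ and $a^*\in\mathcal A_s^*$; (iii) $\pi_\infty(a^*|s)\in\mathrm{int}\,\mathrm{dom}\,\psi$ for all $s\in\mathcal S_{>1}$ and $a^*\in\mathcal A_s^*$.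
   Context: MDP: $(\mathcal S,\mathcal A,P,r,\gamma)$ is a finite discounted Markov decision process: finite state space $\mathcal S$, finite action space $\mathcal A$, transition model $P(\cdot|s,a)\in\Delta(\mathcal S)$, reward $r:\mathcal S\times\mathcal A\to[0,1]$, discount $\gamma\in[0,1)$. $\Delta(\mathcal X)$ is the probability simplex over a finite set $\mathcal X$. A policy $\pi$ assigns to each $s$ a distribution $\pi(\cdot|s)\in\Delta(\mathcal A)$; $\Pi$ is the set of all policies. $V^\pi(s)$ is the expected value of $\sum_{t\ge0}\gamma^t r(s_t,a_t)$ given $s_0=s$, $a_t\sim\pi(\cdot|s_t)$, $s_{t+1}\sim P(\cdot|s_t,a_t)$, and $Q^\pi(s,a)$ is the same conditioned on $(s_0,a_0)=(s,a)$. $V^*(s)=\max_{\pi\in\Pi}V^\pi(s)$, $Q^*(s,a)=\max_{\pi\in\Pi}Q^\pi(s,a)$; $\Pi^*$ is the set of optimal policies ($V^\pi=V^*$). $\mathcal A^*_s=\{a: Q^*(s,a)=V^*(s)\}$, $\mathcal S_{=1}=\{s:|\mathcal A_s^*|=1\}$, $\mathcal S_{>1}=\{s:|\mathcal A_s^*|>1\}$, $\tilde{\mathcal S}=\{s:\mathcal A_s^*\ne\mathcal A\}$, the last assumed nonempty throughout. Mirror map: $\psi:\mathbb R\to(-\infty,+\infty]$ satisfies: (a) $\mathrm{dom}\,\psi\supseteq[0,1]$; (b) $\psi$ is proper, closed and convex; (c) $\psi$ is differentiable on $\mathrm{int}\,\mathrm{dom}\,\psi$ and $|\psi'(x_n)|\to\infty$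 for every sequence $\{x_n\}\subseteq\mathrm{int}\,\mathrm{dom}\,\psi$ converging to a boundary point of $\mathrm{dom}\,\psi$; (d) $\psi$ is strictly convex on $\mathrm{int}\,\mathrm{dom}\,\psi$. $h(p)=\sum_{a\in\mathcal A}\psi(p(a))$ and $D_h(p\|q)=h(p)-h(q)-\langle\nabla h(q),p-q\rangle$. PMD: given $\eta>0$ and an initial policy $\pi_0$ with $\pi_0(a|s)\in\mathrm{int}\,\mathrm{dom}\,\psi$ for all $(s,a)$ (assumed throughout), for each $s$, $\pi_{k+1}(\cdot|s)=\arg\max_{p\in\Delta(\mathcal A)}\{\eta\langle p,Q^{\pi_k}(s,\cdot)\rangle-D_h(p\|\pi_k(\cdot|s))\}$; all iterates satisfy $\pi_k(a|s)\in\mathrm{int}\,\mathrm{dom}\,\psi$. *)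

theory Defs
  imports "HOL-Probability.Probability"
begin

section \<open>Finite discounted Markov decision processes\<close>

text \<open>
  States and actions are elements of finite types. The simplex over a finite set is the type
  of probability mass functions on it, so the set of all policies is the whole type
  \<^typ>\<open>'s \<Rightarrow> 'a pmf\<close>.
\<close>

type_synonym ('s, 'a) transition = "'s \<Rightarrow> 'a \<Rightarrow> 's pmf"
type_synonym ('s, 'a) policy = "'s \<Rightarrow> 'a pmf"

definition step_pmf :: "('s, 'a) transition \<Rightarrow> ('s, 'a) policy \<Rightarrow> 's \<times> 'a \<Rightarrow> ('s \<times> 'a) pmf" where
  "step_pmf P \<pi> = (\<lambda>(s, a). bind_pmf (P s a) (\<lambda>s'. map_pmf (Pair s') (\<pi> s')))"

definition traj_kernel ::
  "('s, 'a) transition \<Rightarrow> ('s, 'a) policy \<Rightarrow> ('s \<times> 'a) pmf \<Rightarrow> nat \<Rightarrow> (nat \<Rightarrow> 's \<times> 'a) \<Rightarrow> ('s \<times> 'a) measure" where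
  "traj_kernel P \<pi> \<mu> t \<omega> = measure_pmf (if t = 0 then \<mu> else step_pmf P \<pi> (\<omega> (t - 1)))"

text \<open>
  The law of the state-action process \<open>(s\<^sub>t, a\<^sub>t)\<close>, \<open>t \<ge> 0\<close>, when \<open>(s\<^sub>0, a\<^sub>0)\<close> has law \<open>\<mu>\<close>: the
  projective limit provided by the Ionescu-Tulcea theorem.
\<close>

definition trajectory ::
  "('s, 'a) transition \<Rightarrow> ('s, 'a) policy \<Rightarrow> ('s \<times> 'a) pmf \<Rightarrow> (nat \<Rightarrow> 's \<times> 'a) measure" where
  "trajectory P \<pi> \<mu> =
     projective_family.lim UNIV
       (Ionescu_Tulcea.CI (traj_kernel P \<pi> \<mu>) (\<lambda>_. count_space UNIV)) (\<lambda>_. count_space UNIV)"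

lemma Ionescu_Tulcea_traj_kernel:
  fixes P :: "('s::finite, 'a::finite) transition"
  shows "Ionescu_Tulcea (traj_kernel P \<pi> \<mu>) (\<lambda>_. count_space UNIV)"
proof (rule Ionescu_Tulcea.intro)
  fix t :: nat
  show "traj_kernel P \<pi> \<mu> t \<in> measurable (PiM {0..<t} (\<lambda>_. count_space UNIV)) (subprob_algebra (count_space UNIV))"
  proof (cases "t = 0")
    case True
    then show ?thesis
      by (simp add: traj_kernel_def[abs_def] measure_pmf_in_subprob_algebra)
  next
    case False
    have "(\<lambda>\<omega>. \<omega> (t - 1)) \<in> measurable (PiM {0..<t} (\<lambda>_. count_space (UNIV :: ('s \<times> 'a) set))) (count_space UNIV)"
      using False by (intro measurable_component_singleton) auto
    moreover have "(\<lambda>x. measure_pmf (step_pmf P \<pi> x)) \<in> measurable (count_space UNIV) (subprob_algebra (count_space UNIV))"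
      by (simp add: measure_pmf_in_subprob_algebra)
    ultimately show ?thesis
      using False measurable_compose by (fastforce simp: traj_kernel_def[abs_def])
  qed
qed (simp add: traj_kernel_def measure_pmf.prob_space_axioms)

definition discounted_return :: "('s \<Rightarrow> 'a \<Rightarrow> real) \<Rightarrow> real \<Rightarrow> (nat \<Rightarrow> 's \<times> 'a) \<Rightarrow> real" where
  "discounted_return r \<gamma> \<omega> = (\<Sum>t. \<gamma> ^ t * r (fst (\<omega> t)) (snd (\<omega> t)))"

definition V_val ::
  "('s, 'a) transition \<Rightarrow> ('s \<Rightarrow> 'a \<Rightarrow> real) \<Rightarrow> real \<Rightarrow> ('s, 'a) policy \<Rightarrow> 's \<Rightarrow> real" where
  "V_val P r \<gamma> \<pi> s =
     (\<integral>\<omega>. discounted_return r \<gamma> \<omega> \<partial>trajectory P \<pi> (map_pmf (Pair s) (\<pi> s)))"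

definition Q_val ::
  "('s, 'a) transition \<Rightarrow> ('s \<Rightarrow> 'a \<Rightarrow> real) \<Rightarrow> real \<Rightarrow> ('s, 'a) policy \<Rightarrow> 's \<Rightarrow> 'a \<Rightarrow> real" where
  "Q_val P r \<gamma> \<pi> s a =
     (\<integral>\<omega>. discounted_return r \<gamma> \<omega> \<partial>trajectory P \<pi> (return_pmf (s, a)))"

text \<open>The maximum over the infinite set of all policies is written as a supremum.\<close>

definition V_star :: "('s, 'a) transition \<Rightarrow> ('s \<Rightarrow> 'a \<Rightarrow> real) \<Rightarrow> real \<Rightarrow> 's \<Rightarrow> real" where
  "V_star P r \<gamma> s = (SUP \<pi>. V_val P r \<gamma> \<pi> s)"

definition Q_star :: "('s, 'a) transition \<Rightarrow> ('s \<Rightarrow> 'a \<Rightarrow> real) \<Rightarrow> real \<Rightarrow> 's \<Rightarrow> 'a \<Rightarrow> real" where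
  "Q_star P r \<gamma> s a = (SUP \<pi>. Q_val P r \<gamma> \<pi> s a)"

definition optimal_policies ::
  "('s, 'a) transition \<Rightarrow> ('s \<Rightarrow> 'a \<Rightarrow> real) \<Rightarrow> real \<Rightarrow> ('s, 'a) policy set" where
  "optimal_policies P r \<gamma> = {\<pi>. \<forall>s. V_val P r \<gamma> \<pi> s = V_star P r \<gamma> s}"

definition optimal_actions ::
  "('s, 'a) transition \<Rightarrow> ('s \<Rightarrow> 'a \<Rightarrow> real) \<Rightarrow> real \<Rightarrow> 's \<Rightarrow> 'a set" where
  "optimal_actions P r \<gamma> s = {a. Q_star P r \<gamma> s a = V_star P r \<gamma> s}"

definition S_eq1 :: "('s, 'a) transition \<Rightarrow> ('s \<Rightarrow> 'a \<Rightarrow> real) \<Rightarrow> real \<Rightarrow> 's set" where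
  "S_eq1 P r \<gamma> = {s. card (optimal_actions P r \<gamma> s) = 1}"

definition S_gt1 :: "('s, 'a) transition \<Rightarrow> ('s \<Rightarrow> 'a \<Rightarrow> real) \<Rightarrow> real \<Rightarrow> 's set" where
  "S_gt1 P r \<gamma> = {s. card (optimal_actions P r \<gamma> s) > 1}"

definition S_tilde :: "('s, 'a) transition \<Rightarrow> ('s \<Rightarrow> 'a \<Rightarrow> real) \<Rightarrow> real \<Rightarrow> 's set" where
  "S_tilde P r \<gamma> = {s. optimal_actions P r \<gamma> s \<noteq> UNIV}"


section \<open>Separable mirror maps\<close>

definition eff_dom :: "(real \<Rightarrow> ereal) \<Rightarrow> real set" where
  "eff_dom \<psi> = {x. \<psi> x < \<infinity>}"

definition ereal_epigraph :: "(real \<Rightarrow> ereal) \<Rightarrow> (real \<times> real) set" where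
  "ereal_epigraph \<psi> = {(x, t). \<psi> x \<le> ereal t}"

text \<open>
  Closedness and convexity of an extended-real-valued function are those of its epigraph.
  On the effective domain a proper \<open>\<psi>\<close> is real-valued, and \<open>\<psi>'\<close> is the derivative of
  \<^term>\<open>real_of_ereal \<circ> \<psi>\<close> there.
\<close>

definition mirror_map :: "(real \<Rightarrow> ereal) \<Rightarrow> bool" where
  "mirror_map \<psi> \<longleftrightarrow>
     {0..1} \<subseteq> eff_dom \<psi> \<and>
     (\<forall>x. \<psi> x \<noteq> -\<infinity>) \<and> eff_dom \<psi> \<noteq> {} \<and>
     closed (ereal_epigraph \<psi>) \<and>
     convex (ereal_epigraph \<psi>) \<and>
     (\<forall>x \<in> interior (eff_dom \<psi>). (real_of_ereal \<circ> \<psi>) differentiable (at x)) \<and>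
     (\<forall>X b. (\<forall>n. X n \<in> interior (eff_dom \<psi>)) \<and> b \<in> frontier (eff_dom \<psi>) \<and> X \<longlonglongrightarrow> b
        \<longrightarrow> filterlim (\<lambda>n. \<bar>deriv (real_of_ereal \<circ> \<psi>) (X n)\<bar>) at_top sequentially) \<and>
     (\<forall>x \<in> interior (eff_dom \<psi>). \<forall>y \<in> interior (eff_dom \<psi>). \<forall>t. x \<noteq> y \<and> 0 < t \<and> t < 1
        \<longrightarrow> \<psi> ((1 - t) * x + t * y) < ereal (1 - t) * \<psi> x + ereal t * \<psi> y)"

definition h_map :: "(real \<Rightarrow> ereal) \<Rightarrow> real ^ 'a::finite \<Rightarrow> ereal" where
  "h_map \<psi> p = (\<Sum>a\<in>UNIV. \<psi> (p $ a))"

text \<open>The description below is meaningful at points \<open>q\<close> with all coordinates in the interior of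
  the effective domain of \<open>\<psi>\<close>; these are the only points at which the gradient is taken.\<close>

definition grad_h :: "(real \<Rightarrow> ereal) \<Rightarrow> real ^ 'a::finite \<Rightarrow> real ^ 'a" where
  "grad_h \<psi> q = (THE D. GDERIV (\<lambda>p. real_of_ereal (h_map \<psi> p)) q :> D)"

definition bregman :: "(real \<Rightarrow> ereal) \<Rightarrow> real ^ 'a::finite \<Rightarrow> real ^ 'a \<Rightarrow> ereal" where
  "bregman \<psi> p q = h_map \<psi> p - h_map \<psi> q - ereal (grad_h \<psi> q \<bullet> (p - q))"


section \<open>Policy mirror descent\<close>

definition pmf_vec :: "'a::finite pmf \<Rightarrow> real ^ 'a" where
  "pmf_vec p = (\<chi> a. pmf p a)"

text \<open>
  The sequence \<open>\<pi>\<close> is generated by PMD. That all later iterates stay in the interior of the domain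
  is a consequence of the properties of \<open>\<psi>\<close> and is not imposed. Likewise the maximiser is unique
  by strict convexity, so being a maximiser is the same as being equal to the argmax.
\<close>

definition is_PMD ::
  "('s::finite, 'a::finite) transition \<Rightarrow> ('s \<Rightarrow> 'a \<Rightarrow> real) \<Rightarrow> real \<Rightarrow> (real \<Rightarrow> ereal) \<Rightarrow> real
    \<Rightarrow> (nat \<Rightarrow> ('s, 'a) policy) \<Rightarrow> bool" where
  "is_PMD P r \<gamma> \<psi> \<eta> \<pi> \<longleftrightarrow>
     (\<forall>s a. pmf (\<pi> 0 s) a \<in> interior (eff_dom \<psi>)) \<and>
     (\<forall>k s. is_arg_max
        (\<lambda>p. ereal (\<eta> * (pmf_vec p \<bullet> (\<chi> a. Q_val P r \<gamma> (\<pi> k) s a)))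
              - bregman \<psi> (pmf_vec p) (pmf_vec (\<pi> k s)))
        (\<lambda>_. True) (\<pi> (Suc k) s))"

end

theory Submission
  imports Defs
begin

text \<open>
  Fix a state and let \<open>A\<close> be its set of optimal actions. Each PMD step is a Bregman proximal step,
  so the divergence \<open>D(z, \<pi>\<^sub>k)\<close> from any fixed distribution \<open>z\<close> grows by at most
  \<open>\<eta>\<langle>\<pi>\<^sub>k\<^sub>+\<^sub>1 - z, Q\<^sub>k\<rangle>\<close> (\<open>mirror_step_divergence_le\<close>). For the point mass \<open>z = e\<^sub>a\<close> at an optimal
  action this growth is at most \<open>\<eta>(V\<^sup>* - Q\<^sub>k(a)) \<le> \<eta>\<parallel>V\<^sup>* - V\<^sub>k\<parallel>\<close>, which is summable.
  So \<open>D(e\<^sub>a, \<pi>\<^sub>k)\<close> converges for every \<open>a \<in> A\<close>.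

  The divergence from a vertex depends on the vertex only through a gradient coordinate:
  \<open>D(e\<^sub>b, \<pi>\<^sub>k) - D(e\<^sub>a, \<pi>\<^sub>k) = \<psi>'(\<pi>\<^sub>k(a)) - \<psi>'(\<pi>\<^sub>k(b))\<close>. Therefore all differences of mirror
  gradients between optimal actions converge (\<open>mirror_gradient_difference_converges\<close>). Two facts
  follow.

  First, the sequence has only one cluster point. The weights of suboptimal actions tend to \<open>0\<close>,
  because the suboptimality averaged under \<open>\<pi>\<^sub>k\<close> is at most \<open>V\<^sup>* - V\<^sub>k\<close>
  (\<open>average_suboptimality_le\<close>). So two cluster points \<open>y \<noteq> z\<close> both put mass \<open>1\<close> on \<open>A\<close>,
  and some optimal \<open>a\<close>, \<open>b\<close> satisfy \<open>y\<^sub>a < z\<^sub>a\<close> and \<open>z\<^sub>b < y\<^sub>b\<close>. As \<open>\<psi>'\<close> is strictly increasing, the gradient difference between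
  \<open>a\<close> and \<open>b\<close> is then strictly smaller along the subsequence to \<open>y\<close> than along the one to \<open>z\<close>, which
  is impossible (\<open>convergent_if_gradient_differences_converge\<close>).

  Second, with several optimal actions the limit is interior on \<open>A\<close>. If an optimal coordinate
  approached a boundary point of the domain, its gradient would be unbounded; but it stays at a
  bounded distance from the gradient of another optimal action whose weight keeps the gradient
  bounded on the relevant side (\<open>limit_interior_if_gradient_differences_converge\<close>).

  The limit is optimal because the Bellman equation passes to the limit and has a unique solution.
  The Bellman equations themselves are derived from the trajectory measure by computing the law of
  the state-action pair at each time.
\<close>

section \<open>The state-action process and the Bellman equations\<close>

primrec state_action_law ::
  "('s, 'a) transition \<Rightarrow> ('s, 'a) policy \<Rightarrow> ('s \<times> 'a) pmf \<Rightarrow> nat \<Rightarrow> ('s \<times> 'a) pmf" where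
  "state_action_law P \<pi> \<mu> 0 = \<mu>"
| "state_action_law P \<pi> \<mu> (Suc t) = bind_pmf (state_action_law P \<pi> \<mu> t) (step_pmf P \<pi>)"

lemma state_action_law_bind:
  "state_action_law P \<pi> (bind_pmf p K) t = bind_pmf p (\<lambda>x. state_action_law P \<pi> (K x) t)"
  by (induction t) (simp_all add: bind_assoc_pmf)

lemma state_action_law_step:
  "state_action_law P \<pi> (step_pmf P \<pi> x) t = state_action_law P \<pi> (return_pmf x) (Suc t)"
  by (induction t) (simp_all add: bind_return_pmf)

text \<open>
  The expected return depends on the trajectory measure only through its one-dimensional marginals.
  By the Ionescu-Tulcea construction the law of the first \<open>n + 1\<close> coordinates arises by appending one
  kernel step at a time, and the kernel reads only the last coordinate; hence the marginals evolve
  by iterating a single transition.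
\<close>
lemma nn_integral_trajectory_coordinate:
  fixes P :: "('s::finite, 'a::finite) transition" and f :: "'s \<times> 'a \<Rightarrow> ennreal"
  shows "(\<integral>\<^sup>+\<omega>. f (\<omega> n) \<partial>trajectory P \<pi> \<mu>) = (\<integral>\<^sup>+x. f x \<partial>state_action_law P \<pi> \<mu> n)"
proof -
  let ?M = "\<lambda>_::nat. count_space (UNIV :: ('s \<times> 'a) set)"
  interpret IT: Ionescu_Tulcea "traj_kernel P \<pi> \<mu>" ?M
    by (rule Ionescu_Tulcea_traj_kernel)
  let ?C = "\<lambda>n. IT.C 0 n (\<lambda>_. undefined)"
  have coord [measurable]: "(\<lambda>\<omega>. f (\<omega> n)) \<in> borel_measurable (PiM J ?M)"
    if "n \<in> J" for f :: "'s \<times> 'a \<Rightarrow> ennreal" and n J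
    by (rule measurable_compose[OF measurable_component_singleton[OF that]]) simp
  have space_C: "space (?C n) = space (PiM {0..<n} ?M)" for n
    by (simp add: IT.space_C space_PiM)
  have sets_C: "sets (?C n) = sets (PiM {0..<n} ?M)" for n
    by (simp add: IT.sets_C space_PiM)
  have last_step: "(\<integral>\<^sup>+\<omega>. f (\<omega> n) \<partial>?C (Suc n)) = (\<integral>\<^sup>+\<omega>. (\<integral>\<^sup>+x. f x \<partial>traj_kernel P \<pi> \<mu> n \<omega>) \<partial>?C n)"
    for f :: "'s \<times> 'a \<Rightarrow> ennreal" and n
  proof -
    have "(\<integral>\<^sup>+\<omega>. f (\<omega> n) \<partial>?C (Suc n)) = (\<integral>\<^sup>+\<omega>. (\<integral>\<^sup>+\<omega>'. f (\<omega>' n) \<partial>IT.eP n \<omega>) \<partial>?C n)"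
      using IT.measurable_eP[of n]
      by (simp, subst nn_integral_bind[where B="PiM {0..<Suc n} ?M"])
        (auto simp: measurable_cong_sets[OF sets_C refl])
    also have "\<dots> = (\<integral>\<^sup>+\<omega>. (\<integral>\<^sup>+x. f x \<partial>traj_kernel P \<pi> \<mu> n \<omega>) \<partial>?C n)"
      by (intro nn_integral_cong) (simp add: space_C IT.nn_integral_eP)
    finally show ?thesis .
  qed
  have C_law: "(\<integral>\<^sup>+\<omega>. f (\<omega> n) \<partial>?C (Suc n)) = (\<integral>\<^sup>+x. f x \<partial>state_action_law P \<pi> \<mu> n)"
    for f :: "'s \<times> 'a \<Rightarrow> ennreal"
  proof (induction n arbitrary: f)
    case 0
    show ?case
      by (subst last_step) (simp add: traj_kernel_def nn_integral_return space_PiM sets_PiM_empty)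
  next
    case (Suc m)
    show ?case
      by (subst last_step)
        (simp add: traj_kernel_def Suc.IH[of "\<lambda>y. \<integral>\<^sup>+x. f x \<partial>step_pmf P \<pi> y"] del: IT.C.simps)
  qed
  let ?J = "{0..<Suc n}"
  have up: "IT.up_to ?J = Suc n"
    by (intro antisym) (auto simp: IT.up_to_iff Suc_le_eq intro: IT.up_to_less)
  have restr: "(\<lambda>x. restrict x ?J) \<in> measurable (PiM UNIV ?M) (PiM ?J ?M)"
    "(\<lambda>x. restrict x ?J) \<in> measurable (PiM ?J ?M) (PiM ?J ?M)"
    by (auto intro!: measurable_restrict)
  have "(\<integral>\<^sup>+\<omega>. f (\<omega> n) \<partial>trajectory P \<pi> \<mu>)
      = (\<integral>\<^sup>+\<omega>. f (\<omega> n) \<partial>distr IT.PF.lim (PiM ?J ?M) (\<lambda>x. restrict x ?J))"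
    by (subst nn_integral_distr)
      (auto simp: trajectory_def measurable_cong_sets[OF IT.PF.sets_lim refl] intro!: restr coord)
  also have "\<dots> = (\<integral>\<^sup>+\<omega>. f (\<omega> n) \<partial>IT.CI ?J)"
    by (subst IT.distr_lim) simp_all
  also have "\<dots> = (\<integral>\<^sup>+\<omega>. f (\<omega> n) \<partial>?C (Suc n))"
    unfolding IT.CI_def up
    by (subst nn_integral_distr)
      (auto simp: measurable_cong_sets[OF sets_C refl] simp del: IT.C.simps intro!: restr coord)
  finally show ?thesis
    using C_law by simp
qed

lemma sets_trajectory:
  fixes P :: "('s::finite, 'a::finite) transition"
  shows "sets (trajectory P \<pi> \<mu>) = sets (PiM UNIV (\<lambda>_. count_space UNIV))"
proof -
  interpret IT: Ionescu_Tulcea "traj_kernel P \<pi> \<mu>" "\<lambda>_. count_space UNIV"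
    by (rule Ionescu_Tulcea_traj_kernel)
  show ?thesis
    by (simp add: trajectory_def)
qed

lemma prob_space_trajectory:
  fixes P :: "('s::finite, 'a::finite) transition"
  shows "prob_space (trajectory P \<pi> \<mu>)"
  using nn_integral_trajectory_coordinate[where f="\<lambda>_. 1" and P=P]
  by (intro prob_spaceI) (simp add: measure_pmf.emeasure_space_1)

lemma distr_trajectory_coordinate:
  fixes P :: "('s::finite, 'a::finite) transition"
  shows "distr (trajectory P \<pi> \<mu>) (count_space UNIV) (\<lambda>\<omega>. \<omega> n) = measure_pmf (state_action_law P \<pi> \<mu> n)"
proof (rule measure_eqI)
  have meas: "(\<lambda>\<omega>. \<omega> n) \<in> measurable (trajectory P \<pi> \<mu>) (count_space UNIV)"
    by (simp add: measurable_cong_sets[OF sets_trajectory refl])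
  fix A :: "('s \<times> 'a) set"
  show "emeasure (distr (trajectory P \<pi> \<mu>) (count_space UNIV) (\<lambda>\<omega>. \<omega> n)) A
      = emeasure (state_action_law P \<pi> \<mu> n) A"
    using nn_integral_trajectory_coordinate[where f="indicator A" and P=P]
      nn_integral_distr[OF meas, of "indicator A"] by simp
qed simp

lemma expectation_finite_type:
  fixes f :: "'b::finite \<Rightarrow> real"
  shows "measure_pmf.expectation p f = (\<Sum>x\<in>UNIV. pmf p x * f x)"
  by (subst integral_measure_pmf_real[where A=UNIV]) (auto simp: mult.commute)

lemma average_ge:
  fixes f :: "'b::finite \<Rightarrow> real"
  assumes "\<And>x. m \<le> f x"
  shows "m \<le> (\<Sum>x\<in>UNIV. pmf p x * f x)"
proof -
  have "m = (\<Sum>x\<in>UNIV. pmf p x * m)"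
    by (simp add: sum_pmf_eq_1 flip: sum_distrib_right)
  also have "\<dots> \<le> (\<Sum>x\<in>UNIV. pmf p x * f x)"
    using assms by (intro sum_mono mult_left_mono) auto
  finally show ?thesis .
qed

lemma average_le:
  fixes f :: "'b::finite \<Rightarrow> real"
  assumes "\<And>x. f x \<le> m"
  shows "(\<Sum>x\<in>UNIV. pmf p x * f x) \<le> m"
  using average_ge[of "- m" "\<lambda>x. - f x" p] assms by (simp add: sum_negf)

locale discounted_mdp =
  fixes P :: "('s::finite, 'a::finite) transition"
    and r :: "'s \<Rightarrow> 'a \<Rightarrow> real"
    and \<gamma> :: real
  assumes r: "\<And>s a. r s a \<in> {0..1}"
    and \<gamma>: "0 \<le> \<gamma>" "\<gamma> < 1"
begin

text \<open>
  Rewards lie in \<open>[0, 1]\<close>, so the geometric series dominates the discounted rewards and the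
  expectation may be taken term by term.
\<close>
lemma expected_return:
  shows "(\<lambda>t. \<gamma> ^ t * measure_pmf.expectation (state_action_law P \<pi> \<mu> t) (\<lambda>(s, a). r s a))
     sums (\<integral>\<omega>. discounted_return r \<gamma> \<omega> \<partial>trajectory P \<pi> \<mu>)"
proof -
  let ?T = "trajectory P \<pi> \<mu>"
  let ?F = "\<lambda>t \<omega>. \<gamma> ^ t * r (fst (\<omega> t)) (snd (\<omega> t))"
  interpret T: prob_space ?T
    by (rule prob_space_trajectory)
  have coord: "(\<lambda>\<omega>. \<omega> t) \<in> measurable ?T (count_space UNIV)" for t
    by (simp add: measurable_cong_sets[OF sets_trajectory refl])
  have meas: "?F t \<in> borel_measurable ?T" for t
    by (rule measurable_compose[OF coord, of "\<lambda>x. \<gamma> ^ t * r (fst x) (snd x)"]) simp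
  have bound: "0 \<le> ?F t \<omega>" "?F t \<omega> \<le> \<gamma> ^ t" for t \<omega>
    using r \<gamma> by (auto intro!: mult_nonneg_nonneg mult_left_le)
  have int: "integrable ?T (?F t)" for t
    by (rule T.integrable_const_bound[where B="\<gamma> ^ t"]) (use bound meas in auto)
  have geo: "summable (\<lambda>t. \<gamma> ^ t)"
    using \<gamma> by simp
  have le: "(\<integral>\<omega>. norm (?F t \<omega>) \<partial>?T) \<le> \<gamma> ^ t" for t
  proof -
    have "(\<integral>\<omega>. norm (?F t \<omega>) \<partial>?T) \<le> (\<integral>\<omega>. \<gamma> ^ t \<partial>?T)"
      by (rule integral_mono) (use int bound in \<open>auto simp del: norm_mult\<close>)
    then show ?thesis
      by (simp add: T.prob_space)
  qed
  have "(\<lambda>t. \<integral>\<omega>. ?F t \<omega> \<partial>?T) sums (\<integral>\<omega>. (\<Sum>t. ?F t \<omega>) \<partial>?T)"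
  proof (rule sums_integral)
    show "AE \<omega> in ?T. summable (\<lambda>t. norm (?F t \<omega>))"
      using bound by (intro AE_I2 summable_comparison_test'[OF geo, of 0]) auto
    show "summable (\<lambda>t. \<integral>\<omega>. norm (?F t \<omega>) \<partial>?T)"
      using le by (intro summable_comparison_test'[OF geo, of 0]) (auto simp del: norm_mult)
  qed (rule int)
  moreover have "(\<integral>\<omega>. ?F t \<omega> \<partial>?T)
      = \<gamma> ^ t * measure_pmf.expectation (state_action_law P \<pi> \<mu> t) (\<lambda>(s, a). r s a)" for t
    using integral_distr[OF coord, of "\<lambda>x. r (fst x) (snd x)" t]
    by (simp add: distr_trajectory_coordinate case_prod_beta')
  ultimately show ?thesis
    unfolding discounted_return_def[abs_def] by (simp only:)
qed

text \<open>
  The expected return is linear in the initial law, because each marginal is. Randomising the first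
  action expresses \<open>V\<close> through \<open>Q\<close>; randomising the next state, after a shift of time, expresses
  \<open>Q\<close> through \<open>V\<close>.
\<close>
lemma expected_return_bind:
  fixes p :: "'b::finite pmf"
  shows "(\<integral>\<omega>. discounted_return r \<gamma> \<omega> \<partial>trajectory P \<pi> (bind_pmf p K))
    = (\<Sum>x\<in>UNIV. pmf p x * (\<integral>\<omega>. discounted_return r \<gamma> \<omega> \<partial>trajectory P \<pi> (K x)))"
proof -
  let ?E = "\<lambda>\<mu> t. measure_pmf.expectation (state_action_law P \<pi> \<mu> t) (\<lambda>(s, a). r s a)"
  have "?E (bind_pmf p K) t = (\<Sum>x\<in>UNIV. pmf p x * ?E (K x) t)" for t
    by (simp add: state_action_law_bind pmf_expectation_bind[where A=UNIV])
  then have "(\<lambda>t. \<Sum>x\<in>UNIV. pmf p x * (\<gamma> ^ t * ?E (K x) t))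
      sums (\<integral>\<omega>. discounted_return r \<gamma> \<omega> \<partial>trajectory P \<pi> (bind_pmf p K))"
    using expected_return[of \<pi> "bind_pmf p K"]
    by (simp add: sum_distrib_left mult.left_commute)
  moreover have "(\<lambda>t. \<Sum>x\<in>UNIV. pmf p x * (\<gamma> ^ t * ?E (K x) t))
      sums (\<Sum>x\<in>UNIV. pmf p x * (\<integral>\<omega>. discounted_return r \<gamma> \<omega> \<partial>trajectory P \<pi> (K x)))"
    by (intro sums_sum sums_mult expected_return)
  ultimately show ?thesis
    by (rule sums_unique2)
qed

lemma V_val_eq_average_Q_val:
  shows "V_val P r \<gamma> \<pi> s = (\<Sum>a\<in>UNIV. pmf (\<pi> s) a * Q_val P r \<gamma> \<pi> s a)"
  unfolding V_val_def Q_val_def map_pmf_def by (rule expected_return_bind)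

lemma Q_val_Bellman:
  shows "Q_val P r \<gamma> \<pi> s a = r s a + \<gamma> * (\<Sum>s'\<in>UNIV. pmf (P s a) s' * V_val P r \<gamma> \<pi> s')"
proof -
  let ?E = "\<lambda>\<mu> t. measure_pmf.expectation (state_action_law P \<pi> \<mu> t) (\<lambda>(s, a). r s a)"
  let ?R = "\<lambda>\<mu>. \<integral>\<omega>. discounted_return r \<gamma> \<omega> \<partial>trajectory P \<pi> \<mu>"
  have "(\<lambda>t. \<gamma> * (\<gamma> ^ t * ?E (step_pmf P \<pi> (s, a)) t)) sums (\<gamma> * ?R (step_pmf P \<pi> (s, a)))"
    by (intro sums_mult expected_return)
  then have "(\<lambda>t. \<gamma> ^ Suc t * ?E (return_pmf (s, a)) (Suc t)) sums (\<gamma> * ?R (step_pmf P \<pi> (s, a)))"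
    by (simp only: state_action_law_step power_Suc mult.assoc)
  from sums_Suc[OF this]
  have "(\<lambda>t. \<gamma> ^ t * ?E (return_pmf (s, a)) t) sums (r s a + \<gamma> * ?R (step_pmf P \<pi> (s, a)))"
    by (simp add: add.commute)
  then have "Q_val P r \<gamma> \<pi> s a = r s a + \<gamma> * ?R (step_pmf P \<pi> (s, a))"
    unfolding Q_val_def by (rule sums_unique2[OF expected_return])
  also have "?R (step_pmf P \<pi> (s, a)) = (\<Sum>s'\<in>UNIV. pmf (P s a) s' * V_val P r \<gamma> \<pi> s')"
    by (simp add: step_pmf_def expected_return_bind V_val_def)
  finally show ?thesis .
qed

lemma expected_return_le:
  "(\<integral>\<omega>. discounted_return r \<gamma> \<omega> \<partial>trajectory P \<pi> \<mu>) \<le> 1 / (1 - \<gamma>)"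
proof -
  let ?E = "\<lambda>t. measure_pmf.expectation (state_action_law P \<pi> \<mu> t) (\<lambda>(s, a). r s a)"
  have E: "?E t \<le> 1" for t
  proof -
    have "?E t \<le> measure_pmf.expectation (state_action_law P \<pi> \<mu> t) (\<lambda>_. 1)"
      using r by (intro integral_mono) (auto intro: integrable_measure_pmf_finite)
    then show ?thesis by simp
  qed
  show ?thesis
  proof (rule sums_le[OF _ expected_return geometric_sums])
    show "\<gamma> ^ t * ?E t \<le> \<gamma> ^ t" for t
      using E \<gamma> by (intro mult_left_le) auto
  qed (use \<gamma> in auto)
qed

section \<open>Optimal values and optimal actions\<close>

abbreviation "V \<equiv> V_val P r \<gamma>"
abbreviation "Q \<equiv> Q_val P r \<gamma>"
abbreviation "V\<^sub>o\<^sub>p\<^sub>t \<equiv> V_star P r \<gamma>"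
abbreviation "Q\<^sub>o\<^sub>p\<^sub>t \<equiv> Q_star P r \<gamma>"
abbreviation "\<A> \<equiv> optimal_actions P r \<gamma>"

lemma V_le_V_star: "V \<pi> s \<le> V\<^sub>o\<^sub>p\<^sub>t s"
  unfolding V_star_def
  by (rule cSUP_upper) (auto intro!: bdd_aboveI2 expected_return_le simp: V_val_def)

lemma Q_le_Q_star: "Q \<pi> s a \<le> Q\<^sub>o\<^sub>p\<^sub>t s a"
  unfolding Q_star_def
  by (rule cSUP_upper) (auto intro!: bdd_aboveI2 expected_return_le simp: Q_val_def)

text \<open>
  A minimum principle: at a minimiser of \<open>d\<close> the discounted average is at least \<open>\<gamma>\<close> times the
  minimum, so the minimum \<open>m\<close> satisfies \<open>\<gamma> m \<le> m\<close>, and \<open>\<gamma> < 1\<close> gives \<open>m \<ge> 0\<close>. It serves both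
  for policy improvement and for uniqueness in the Bellman equation.
\<close>
lemma discounted_superharmonic_nonneg:
  fixes d :: "'s \<Rightarrow> real" and p :: "('s, 'a) policy"
  assumes d: "\<And>s. \<gamma> * (\<Sum>a\<in>UNIV. pmf (p s) a * (\<Sum>s'\<in>UNIV. pmf (P s a) s' * d s')) \<le> d s"
  shows "0 \<le> d s"
proof -
  obtain s0 where s0: "\<And>s. d s0 \<le> d s"
    using ex_min_if_finite[of "range d"] by (auto simp: not_less)
  have "\<gamma> * d s0 \<le> \<gamma> * (\<Sum>a\<in>UNIV. pmf (p s0) a * (\<Sum>s'\<in>UNIV. pmf (P s0 a) s' * d s'))"
    using s0 \<gamma> by (intro mult_left_mono average_ge) auto
  with d[of s0] have "0 \<le> (1 - \<gamma>) * d s0"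
    by (simp add: algebra_simps)
  with \<gamma> have "0 \<le> d s0"
    by (simp add: zero_le_mult_iff)
  with s0[of s] show ?thesis by simp
qed

lemma Q_val_diff:
  "Q \<pi>' s a - Q \<pi> s a = \<gamma> * (\<Sum>s'\<in>UNIV. pmf (P s a) s' * (V \<pi>' s' - V \<pi> s'))"
  by (simp add: Q_val_Bellman sum_subtractf algebra_simps)

text \<open>
  The gain \<open>V \<pi>' - V \<pi>\<close> is superharmonic for the transitions under \<open>\<pi>'\<close>.
\<close>
lemma policy_improvement:
  assumes "\<And>s. V \<pi> s \<le> (\<Sum>a\<in>UNIV. pmf (\<pi>' s) a * Q \<pi> s a)"
  shows "V \<pi> s \<le> V \<pi>' s"
proof -
  have "\<gamma> * (\<Sum>a\<in>UNIV. pmf (\<pi>' s) a * (\<Sum>s'\<in>UNIV. pmf (P s a) s' * (V \<pi>' s' - V \<pi> s')))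
      = (\<Sum>a\<in>UNIV. pmf (\<pi>' s) a * (Q \<pi>' s a - Q \<pi> s a))" for s
    by (simp add: Q_val_diff sum_distrib_left mult_ac)
  also have "\<dots> s \<le> V \<pi>' s - V \<pi> s" for s
    using assms[of s] by (simp add: V_val_eq_average_Q_val[of \<pi>' s] right_diff_distrib sum_subtractf)
  finally show ?thesis
    using discounted_superharmonic_nonneg[of \<pi>' "\<lambda>s. V \<pi>' s - V \<pi> s" s] by simp
qed

text \<open>
  \<open>Q\<^sup>\<pi>(s, a)\<close> is the value of playing \<open>a\<close> once and following \<open>\<pi>\<close> afterwards, which is no
  stationary policy. If that deviation pays off, then always playing \<open>a\<close> in \<open>s\<close> improves on \<open>\<pi>\<close> in
  every state, and this stationary policy attains at least \<open>Q\<^sup>\<pi>(s, a)\<close>.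
\<close>
lemma Q_le_V_star: "Q \<pi> s a \<le> V\<^sub>o\<^sub>p\<^sub>t s"
proof (cases "Q \<pi> s a \<le> V \<pi> s")
  case True
  then show ?thesis
    using V_le_V_star order_trans by blast
next
  case False
  define \<pi>' where "\<pi>' = \<pi>(s := return_pmf a)"
  have deviate: "(\<Sum>b\<in>UNIV. pmf (\<pi>' s) b * f b) = f a" for f :: "'a \<Rightarrow> real"
    by (simp add: \<pi>'_def flip: expectation_finite_type)
  have "V \<pi> s' \<le> (\<Sum>b\<in>UNIV. pmf (\<pi>' s') b * Q \<pi> s' b)" for s'
    using False deviate[of "Q \<pi> s"]
    by (cases "s' = s") (auto simp: \<pi>'_def V_val_eq_average_Q_val)
  then have "V \<pi> s' \<le> V \<pi>' s'" for s'
    by (rule policy_improvement)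
  then have "0 \<le> Q \<pi>' s a - Q \<pi> s a"
    unfolding Q_val_diff using \<gamma> by (intro mult_nonneg_nonneg sum_nonneg) auto
  also have "Q \<pi>' s a = V \<pi>' s"
    using deviate by (simp add: V_val_eq_average_Q_val)
  also note V_le_V_star[of \<pi>' s]
  finally show ?thesis by simp
qed

lemma Q_star_le_V_star: "Q\<^sub>o\<^sub>p\<^sub>t s a \<le> V\<^sub>o\<^sub>p\<^sub>t s"
  unfolding Q_star_def by (rule cSUP_least) (auto intro: Q_le_V_star)

text \<open>
  Every \<open>V\<^sup>\<pi>(s)\<close> is an average of values \<open>Q\<^sup>\<pi>(s, \<cdot>)\<close>, hence at most
  the largest of the finitely many \<open>Q\<^sup>*(s, \<cdot>)\<close>.
\<close>
lemma optimal_action_exists: "\<exists>a. a \<in> \<A> s"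
proof -
  obtain a where a: "\<And>b. Q\<^sub>o\<^sub>p\<^sub>t s b \<le> Q\<^sub>o\<^sub>p\<^sub>t s a"
    using Max_in[of "range (Q\<^sub>o\<^sub>p\<^sub>t s)"] Max_ge[of "range (Q\<^sub>o\<^sub>p\<^sub>t s)"] by fastforce
  have "V \<pi> s \<le> Q\<^sub>o\<^sub>p\<^sub>t s a" for \<pi>
    unfolding V_val_eq_average_Q_val using a Q_le_Q_star[of \<pi> s]
    by (intro average_le) (rule order_trans)
  then have "V\<^sub>o\<^sub>p\<^sub>t s \<le> Q\<^sub>o\<^sub>p\<^sub>t s a"
    unfolding V_star_def by (intro cSUP_least) auto
  with Q_star_le_V_star[of s a] show ?thesis
    by (auto simp: optimal_actions_def)
qed

text \<open>
  The Bellman equation averages the gap between the values over the next state.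
\<close>
lemma Q_star_minus_Q_le:
  "Q\<^sub>o\<^sub>p\<^sub>t s a - Q \<pi> s a \<le> infnorm (\<chi> s. V\<^sub>o\<^sub>p\<^sub>t s - V \<pi> s)" (is "_ \<le> ?e")
proof -
  have "V \<pi>' s' - V \<pi> s' \<le> ?e" for \<pi>' s'
    using V_le_V_star[of \<pi>' s'] component_le_infnorm_cart[of "\<chi> s. V\<^sub>o\<^sub>p\<^sub>t s - V \<pi> s" s'] by simp
  then have "Q \<pi>' s a - Q \<pi> s a \<le> \<gamma> * ?e" for \<pi>'
    unfolding Q_val_diff using \<gamma> by (intro mult_left_mono average_le) auto
  also have "\<gamma> * ?e \<le> ?e"
    using \<gamma> by (simp add: mult_left_le_one_le infnorm_pos_le)
  finally have "Q\<^sub>o\<^sub>p\<^sub>t s a \<le> Q \<pi> s a + ?e"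
    unfolding Q_star_def by (intro cSUP_least) (auto simp: algebra_simps)
  then show ?thesis by simp
qed

text \<open>
  A policy of nearly optimal value can give little weight to suboptimal actions.
\<close>
lemma average_suboptimality_le:
  "(\<Sum>a\<in>UNIV. pmf (\<pi> s) a * (V\<^sub>o\<^sub>p\<^sub>t s - Q\<^sub>o\<^sub>p\<^sub>t s a)) \<le> V\<^sub>o\<^sub>p\<^sub>t s - V \<pi> s"
proof -
  have "V \<pi> s \<le> (\<Sum>a\<in>UNIV. pmf (\<pi> s) a * Q\<^sub>o\<^sub>p\<^sub>t s a)"
    unfolding V_val_eq_average_Q_val by (intro sum_mono mult_left_mono Q_le_Q_star) simp
  then show ?thesis
    by (simp add: right_diff_distrib sum_subtractf sum_pmf_eq_1 flip: sum_distrib_right)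
qed

text \<open>
  In the limit, \<open>V\<^sup>*\<close> satisfies the Bellman equation of the limit policy, whose only solution is the
  value of that policy.
\<close>
lemma limit_of_asymptotically_optimal_policies:
  assumes V: "\<And>s. (\<lambda>k. V (\<pi> k) s) \<longlonglongrightarrow> V\<^sub>o\<^sub>p\<^sub>t s"
    and \<pi>: "\<And>s a. (\<lambda>k. pmf (\<pi> k s) a) \<longlonglongrightarrow> pmf (p s) a"
  shows "p \<in> optimal_policies P r \<gamma>"
proof -
  let ?T = "\<lambda>p v s. \<Sum>a\<in>UNIV. pmf (p s) a * (r s a + \<gamma> * (\<Sum>s'\<in>UNIV. pmf (P s a) s' * v s'))"
  have Bellman: "V p s = ?T p (V p) s" for p s
    by (simp add: V_val_eq_average_Q_val[of p s] Q_val_Bellman)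
  have "(\<lambda>k. ?T (\<pi> k) (V (\<pi> k)) s) \<longlonglongrightarrow> ?T p V\<^sub>o\<^sub>p\<^sub>t s" for s
    by (intro tendsto_intros V \<pi>)
  then have star: "V\<^sub>o\<^sub>p\<^sub>t s = ?T p V\<^sub>o\<^sub>p\<^sub>t s" for s
    using V[of s] LIMSEQ_unique unfolding Bellman[symmetric] by blast
  have "\<gamma> * (\<Sum>a\<in>UNIV. pmf (p s) a * (\<Sum>s'\<in>UNIV. pmf (P s a) s' * (V p s' - V\<^sub>o\<^sub>p\<^sub>t s')))
      = V p s - V\<^sub>o\<^sub>p\<^sub>t s" for s
    unfolding Bellman[of p s] star[of s]
    by (simp add: sum_distrib_left sum_subtractf distrib_left right_diff_distrib sum.distrib mult_ac)
  then have "0 \<le> V p s - V\<^sub>o\<^sub>p\<^sub>t s" for s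
    by (intro discounted_superharmonic_nonneg[of p]) simp
  then have "V p s = V\<^sub>o\<^sub>p\<^sub>t s" for s
    using V_le_V_star[of p s] by (intro antisym) auto
  then show ?thesis
    by (simp add: optimal_policies_def)
qed

end

section \<open>Limits and gradients\<close>

lemma pmf_of_simplex_point:
  fixes f :: "'a::finite \<Rightarrow> real"
  assumes "\<And>x. 0 \<le> f x" and "(\<Sum>x\<in>UNIV. f x) = 1"
  obtains p where "\<And>x. pmf p x = f x"
proof
  show "pmf (embed_pmf f) x = f x" for x
    using assms by (intro pmf_embed_pmf) (auto simp: nn_integral_count_space_finite)
qed

text \<open>
  Subtracting the accumulated increments leaves a decreasing sequence that is bounded below.
\<close>
lemma convergent_if_summable_increase:
  fixes u :: "nat \<Rightarrow> real"
  assumes nonneg: "\<And>k. 0 \<le> u k" and incr: "\<And>k. u (Suc k) \<le> u k + e k"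
    and e: "\<And>k. 0 \<le> e k" "summable e"
  shows "convergent u"
proof -
  define w where "w k = u k - (\<Sum>j<k. e j)" for k
  have "decseq w"
    using incr by (intro decseq_SucI) (simp add: w_def algebra_simps)
  moreover have "- suminf e \<le> w k" for k
    using nonneg[of k] sum_le_suminf[OF e(2), of "{..<k}"] e(1) by (simp add: w_def)
  ultimately have "convergent w"
    using decseq_convergent convergentI by metis
  moreover have "convergent (\<lambda>k. \<Sum>j<k. e j)"
    using e(2) by (simp add: summable_iff_convergent)
  ultimately have "convergent (\<lambda>k. w k + (\<Sum>j<k. e j))"
    by (rule convergent_add)
  then show ?thesis
    by (simp add: w_def)
qed

lemma convergent_if_unique_cluster_point:
  fixes Y :: "nat \<Rightarrow> 'b::metric_space"
  assumes K: "compact K" "\<And>k. Y k \<in> K"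
    and unique: "\<And>\<rho> \<sigma> x y. \<lbrakk>strict_mono \<rho>; strict_mono \<sigma>; (Y \<circ> \<rho>) \<longlonglongrightarrow> x; (Y \<circ> \<sigma>) \<longlonglongrightarrow> y\<rbrakk> \<Longrightarrow> x = y"
  shows "convergent Y"
proof -
  obtain x \<rho> where x: "strict_mono \<rho>" "(Y \<circ> \<rho>) \<longlonglongrightarrow> x"
    using K compact_imp_seq_compact seq_compactE by metis
  have "Y \<longlonglongrightarrow> x"
  proof (rule ccontr)
    assume "\<not> Y \<longlonglongrightarrow> x"
    then obtain \<epsilon> where \<epsilon>: "\<epsilon> > 0" "\<exists>\<^sub>F n in sequentially. \<epsilon> \<le> dist (Y n) x"
      unfolding tendsto_iff by (auto simp: frequently_def not_le)
    define S where "S = {n. \<epsilon> \<le> dist (Y n) x}"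
    have "infinite S"
      using \<epsilon>(2) by (simp add: S_def frequently_cofinite[symmetric] cofinite_eq_sequentially)
    then have S: "strict_mono (enumerate S)" "enumerate S n \<in> S" for n
      by (auto simp: strict_mono_enumerate enumerate_in_set)
    have "\<forall>n. (Y \<circ> enumerate S) n \<in> K"
      using K(2) by simp
    from seq_compactE[OF compact_imp_seq_compact[OF K(1)] this]
    obtain y \<sigma> where y: "strict_mono \<sigma>" "((Y \<circ> enumerate S) \<circ> \<sigma>) \<longlonglongrightarrow> y"
      by blast
    have "(Y \<circ> (enumerate S \<circ> \<sigma>)) \<longlonglongrightarrow> y"
      using y(2) by (simp only: comp_assoc)
    then have "y = x"
      using unique strict_mono_o[OF S(1) y(1)] x by blast
    have "(\<lambda>n. dist (Y (enumerate S (\<sigma> n))) x) \<longlonglongrightarrow> dist y x"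
      using y(2) by (intro tendsto_dist tendsto_const) (simp add: comp_def)
    moreover have "\<epsilon> \<le> dist (Y (enumerate S (\<sigma> n))) x" for n
      using S(2)[of "\<sigma> n"] by (simp add: S_def)
    ultimately have "\<epsilon> \<le> dist y x"
      by (intro LIMSEQ_le_const) blast+
    with \<open>y = x\<close> have "\<epsilon> \<le> 0"
      by simp
    with \<epsilon>(1) show False by simp
  qed
  then show ?thesis
    by (rule convergentI)
qed

lemma GDERIV_sum_coordinates:
  fixes F G :: "real \<Rightarrow> real" and q :: "real ^ 'a::finite"
  assumes "\<And>a. (F has_real_derivative G (q $ a)) (at (q $ a))"
  shows "GDERIV (\<lambda>p. \<Sum>a\<in>UNIV. F (p $ a)) q :> (\<chi> a. G (q $ a))"
proof -
  have coord: "((\<lambda>p. p $ a) has_derivative (\<lambda>h. h $ a)) (at q)" for a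
    by (rule bounded_linear_imp_has_derivative) (rule bounded_linear_vec_nth)
  have "((\<lambda>p. F (p $ a)) has_derivative (\<lambda>h. h $ a * G (q $ a))) (at q)" for a
    using has_derivative_compose[OF coord, of F "(*) (G (q $ a))" a] assms[of a]
    by (simp add: has_field_derivative_def mult.commute)
  then have "((\<lambda>p. \<Sum>a\<in>UNIV. F (p $ a)) has_derivative (\<lambda>h. \<Sum>a\<in>UNIV. h $ a * G (q $ a))) (at q)"
    by (rule has_derivative_sum)
  then show ?thesis
    by (simp add: gderiv_def inner_vec_def)
qed

section \<open>Separable mirror maps\<close>

locale separable_mirror_map =
  fixes \<psi> :: "real \<Rightarrow> ereal"
  assumes mirror: "mirror_map \<psi>"
begin

abbreviation "\<phi> \<equiv> real_of_ereal \<circ> \<psi>"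
abbreviation "g \<equiv> deriv \<phi>"
abbreviation "dom\<^sub>\<psi> \<equiv> eff_dom \<psi>"

text \<open>
  The Bregman divergence of \<open>h\<close> between distributions, as a real number (see \<open>bregman_eq_D\<close>). The
  second argument is meant to have all its coordinates in the interior of the domain.
\<close>
definition D :: "'a pmf \<Rightarrow> 'a pmf \<Rightarrow> real" where
  "D p q = (\<Sum>a\<in>UNIV. \<phi> (pmf p a) - \<phi> (pmf q a) - g (pmf q a) * (pmf p a - pmf q a))"

lemma ereal_\<phi>: "x \<in> dom\<^sub>\<psi> \<Longrightarrow> ereal (\<phi> x) = \<psi> x"
  using mirror by (cases "\<psi> x") (auto simp: mirror_map_def eff_dom_def)

lemma convex_combination:
  assumes "x \<in> dom\<^sub>\<psi>" "y \<in> dom\<^sub>\<psi>" "0 \<le> u" "0 \<le> v" "u + v = 1"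
  shows "\<psi> (u * x + v * y) \<le> ereal (u * \<phi> x + v * \<phi> y)"
proof -
  have "(x, \<phi> x) \<in> ereal_epigraph \<psi>" "(y, \<phi> y) \<in> ereal_epigraph \<psi>"
    using assms(1,2) ereal_\<phi> by (simp_all add: ereal_epigraph_def)
  then have "u *\<^sub>R (x, \<phi> x) + v *\<^sub>R (y, \<phi> y) \<in> ereal_epigraph \<psi>"
    using mirror assms unfolding mirror_map_def by (blast intro: convexD)
  then show ?thesis
    by (simp add: ereal_epigraph_def)
qed

lemma convex_dom: "convex dom\<^sub>\<psi>"
  unfolding convex_def
  using convex_combination by (force simp: eff_dom_def intro: le_less_trans)

lemma convex_on_\<phi>: "convex_on dom\<^sub>\<psi> \<phi>"
proof (rule convex_onI[OF _ convex_dom])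
  fix t x y :: real
  assume "0 < t" "t < 1" and xy: "x \<in> dom\<^sub>\<psi>" "y \<in> dom\<^sub>\<psi>"
  then have "\<psi> ((1 - t) * x + t * y) \<le> ereal ((1 - t) * \<phi> x + t * \<phi> y)"
    by (intro convex_combination) auto
  moreover from this have "(1 - t) * x + t * y \<in> dom\<^sub>\<psi>"
    by (auto simp: eff_dom_def intro: le_less_trans)
  ultimately show "\<phi> ((1 - t) *\<^sub>R x + t *\<^sub>R y) \<le> (1 - t) * \<phi> x + t * \<phi> y"
    using ereal_\<phi> by (metis ereal_less_eq(3) real_scaleR_def)
qed

lemma DERIV_\<phi>: "x \<in> interior dom\<^sub>\<psi> \<Longrightarrow> (\<phi> has_real_derivative g x) (at x)"
  using mirror unfolding mirror_map_def
  by (metis DERIV_deriv_iff_real_differentiable)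

lemma tangent_le:
  assumes "y \<in> interior dom\<^sub>\<psi>" "x \<in> dom\<^sub>\<psi>"
  shows "\<phi> y + g y * (x - y) \<le> \<phi> x"
  using convex_on_imp_above_tangent[OF convex_on_\<phi> convex_connected[OF convex_dom] assms
      has_field_derivative_at_within[OF DERIV_\<phi>[OF assms(1)]]] by simp

text \<open>
  If \<open>g y \<le> g x\<close>, the two tangent lines bound \<open>\<phi>\<close> at the midpoint from below by the
  chord, against strict convexity.
\<close>
lemma g_strict_mono:
  assumes x: "x \<in> interior dom\<^sub>\<psi>" and y: "y \<in> interior dom\<^sub>\<psi>" and "x < y"
  shows "g x < g y"
proof (rule ccontr)
  assume "\<not> g x < g y"
  define m where "m = (1 - 1/2) * x + 1/2 * y"
  have dom\<^sub>\<psi>: "x \<in> dom\<^sub>\<psi>" "y \<in> dom\<^sub>\<psi>"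
    using x y interior_subset by auto
  have m: "m \<in> dom\<^sub>\<psi>"
    unfolding m_def using convexD[OF convex_dom dom\<^sub>\<psi>, of "1 - 1/2" "1/2"] by simp
  have "\<psi> m < ereal (1 - 1/2) * \<psi> x + ereal (1/2) * \<psi> y"
  proof -
    have "x \<noteq> y \<and> 0 < (1/2 :: real) \<and> (1/2 :: real) < 1"
      using \<open>x < y\<close> by simp
    then show ?thesis
      using mirror x y unfolding mirror_map_def m_def by blast
  qed
  then have "ereal (\<phi> m) < ereal (1 - 1/2) * ereal (\<phi> x) + ereal (1/2) * ereal (\<phi> y)"
    by (simp only: ereal_\<phi> m dom\<^sub>\<psi>)
  then have "2 * \<phi> m < \<phi> x + \<phi> y"
    by (simp add: field_simps)
  moreover have "\<phi> x + g x * (m - x) \<le> \<phi> m" "\<phi> y + g y * (m - y) \<le> \<phi> m"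
    using tangent_le x y m by auto
  moreover have "g y * ((y - x) / 2) \<le> g x * ((y - x) / 2)"
    using \<open>\<not> g x < g y\<close> \<open>x < y\<close> by (intro mult_right_mono) auto
  moreover have "m - x = (y - x) / 2" "m - y = - ((y - x) / 2)"
    by (simp_all add: m_def field_simps)
  ultimately show False
    by simp
qed

lemma g_monotone:
  assumes "x \<in> interior dom\<^sub>\<psi>" "y \<in> interior dom\<^sub>\<psi>"
  shows "x \<le> y \<Longrightarrow> g x \<le> g y" and "0 \<le> (g y - g x) * (y - x)"
  using g_strict_mono[OF assms] g_strict_mono[OF assms(2,1)]
  by (cases x y rule: linorder_cases; simp add: zero_le_mult_iff)+

lemma unit_interval_dom: "0 \<le> x \<Longrightarrow> x \<le> 1 \<Longrightarrow> x \<in> dom\<^sub>\<psi>"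
  using mirror by (auto simp: mirror_map_def)

lemma pmf_dom: "pmf p a \<in> dom\<^sub>\<psi>"
  by (simp add: unit_interval_dom pmf_le_1)

lemma open_unit_interval_interior: "0 < x \<Longrightarrow> x < 1 \<Longrightarrow> x \<in> interior dom\<^sub>\<psi>"
  using interior_mono[of "{0..1}" dom\<^sub>\<psi>] unit_interval_dom by (auto simp: subset_iff)

lemma shrink_interior:
  assumes "x \<in> dom\<^sub>\<psi>" "c \<in> interior dom\<^sub>\<psi>" "0 < t" "t \<le> 1"
  shows "x + t * (c - x) \<in> interior dom\<^sub>\<psi>"
  using mem_interior_convex_shrink[OF convex_dom assms(2,1,3,4)] by (simp add: algebra_simps)

lemma g_unbounded_near_frontier:
  assumes "\<And>n. X n \<in> interior dom\<^sub>\<psi>" "X \<longlonglongrightarrow> b" "b \<in> dom\<^sub>\<psi>" "b \<notin> interior dom\<^sub>\<psi>"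
    and bound: "\<forall>\<^sub>F n in sequentially. \<bar>g (X n)\<bar> \<le> B"
  shows False
proof -
  have "b \<in> frontier dom\<^sub>\<psi>"
    using assms(3,4) closure_subset by (auto simp: frontier_def)
  then have "filterlim (\<lambda>n. \<bar>g (X n)\<bar>) at_top sequentially"
    using mirror assms(1,2) unfolding mirror_map_def by blast
  then have "\<forall>\<^sub>F n in sequentially. B + 1 \<le> \<bar>g (X n)\<bar>"
    by (simp add: filterlim_at_top)
  with bound have "\<forall>\<^sub>F n in sequentially. False"
    by eventually_elim simp
  then show False by simp
qed

lemma h_map_eq: "(\<And>a. p $ a \<in> dom\<^sub>\<psi>) \<Longrightarrow> h_map \<psi> p = ereal (\<Sum>a\<in>UNIV. \<phi> (p $ a))"
  unfolding h_map_def using ereal_\<phi> by (simp flip: sum_ereal)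

text \<open>
  The function \<open>h\<close> may be infinite elsewhere, so its gradient is computed on the open set of points
  whose coordinates all lie in the interior of the domain.
\<close>
lemma grad_h_eq:
  fixes q :: "real ^ 'a::finite"
  assumes q: "\<And>a. q $ a \<in> interior dom\<^sub>\<psi>"
  shows "grad_h \<psi> q = (\<chi> a. g (q $ a))"
proof -
  let ?U = "{p :: real ^ 'a. \<forall>a. p $ a \<in> interior dom\<^sub>\<psi>}"
  have "open ((\<lambda>p :: real ^ 'a. p $ a) -` interior dom\<^sub>\<psi>)" for a
    by (intro open_vimage open_interior continuous_intros)
  then have "open (\<Inter>a. (\<lambda>p :: real ^ 'a. p $ a) -` interior dom\<^sub>\<psi>)"
    by (intro open_INT) auto
  also have "(\<Inter>a. (\<lambda>p :: real ^ 'a. p $ a) -` interior dom\<^sub>\<psi>) = ?U"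
    by auto
  finally have U: "open ?U" .
  have "GDERIV (\<lambda>p. \<Sum>a\<in>UNIV. \<phi> (p $ a)) q :> (\<chi> a. g (q $ a))"
    using q by (intro GDERIV_sum_coordinates DERIV_\<phi>)
  moreover have "real_of_ereal (h_map \<psi> p) = (\<Sum>a\<in>UNIV. \<phi> (p $ a))" if "p \<in> ?U" for p
    using that interior_subset[of dom\<^sub>\<psi>] by (subst h_map_eq) auto
  ultimately have grad: "GDERIV (\<lambda>p. real_of_ereal (h_map \<psi> p)) q :> (\<chi> a. g (q $ a))"
    unfolding gderiv_def using q by (auto elim!: has_derivative_transform_within_open[OF _ U])
  show ?thesis
    unfolding grad_h_def
  proof (rule the_equality)
    show "GDERIV (\<lambda>p. real_of_ereal (h_map \<psi> p)) q :> (\<chi> a. g (q $ a))"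
      by (fact grad)
  next
    fix d :: "real ^ 'a"
    assume "GDERIV (\<lambda>p. real_of_ereal (h_map \<psi> p)) q :> d"
    then have "(\<lambda>h. h \<bullet> d) = (\<lambda>h. h \<bullet> (\<chi> a. g (q $ a)))"
      using grad unfolding gderiv_def by (rule has_derivative_unique)
    then show "d = (\<chi> a. g (q $ a))"
      by (metis inner_commute vector_eq_rdot)
  qed
qed

lemma bregman_eq_D:
  fixes p q :: "'a::finite pmf"
  assumes "\<And>a. pmf q a \<in> interior dom\<^sub>\<psi>"
  shows "bregman \<psi> (pmf_vec p) (pmf_vec q) = ereal (D p q)"
  using assms
  by (simp add: bregman_def h_map_eq grad_h_eq pmf_vec_def pmf_dom D_def inner_vec_def sum_subtractf)

lemma D_nonneg: "(\<And>a. pmf q a \<in> interior dom\<^sub>\<psi>) \<Longrightarrow> 0 \<le> D p q"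
  unfolding D_def using tangent_le[OF _ pmf_dom, of "pmf q a" p a for a]
  by (intro sum_nonneg) (simp add: algebra_simps)

text \<open>
  All point masses have the same value of \<open>h\<close>, so among the terms of the divergence only the
  gradient coordinate at the chosen vertex distinguishes them.
\<close>
lemma D_vertex_diff:
  fixes q :: "'a::finite pmf"
  shows "D (return_pmf b) q - D (return_pmf a) q = g (pmf q a) - g (pmf q b)"
proof -
  have vertex: "D (return_pmf a) q = real CARD('a) * \<phi> 0 + \<phi> 1 - \<phi> 0
      - (\<Sum>c\<in>UNIV. \<phi> (pmf q c) - g (pmf q c) * pmf q c) - g (pmf q a)" for a
  proof -
    have ind: "pmf (return_pmf a) c = of_bool (c = a)" for c
      by (simp add: pmf_return indicator_def)
    have split: "\<phi> (of_bool (c = a)) = \<phi> 0 + (if c = a then \<phi> 1 - \<phi> 0 else 0)" for c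
      by simp
    have pick: "g (pmf q c) * of_bool (c = a) = (if c = a then g (pmf q a) else 0)" for c
      by simp
    show ?thesis
      unfolding D_def ind right_diff_distrib split pick
      by (simp add: sum_subtractf sum.distrib algebra_simps)
  qed
  show ?thesis
    unfolding vertex by simp
qed

section \<open>A single mirror descent step\<close>

text \<open>
  A PMD step in one state, where \<open>c\<close> is \<open>\<eta>\<close> times the action values there.
\<close>
definition mirror_step :: "('a::finite \<Rightarrow> real) \<Rightarrow> 'a pmf \<Rightarrow> 'a pmf \<Rightarrow> bool" where
  "mirror_step c x p \<longleftrightarrow>
     (\<forall>z. (\<Sum>a\<in>UNIV. c a * pmf z a) - D z x \<le> (\<Sum>a\<in>UNIV. c a * pmf p a) - D p x)"

text \<open>
  Optimality of \<open>p\<close> tested at a point of the segment from \<open>p\<close> to \<open>z\<close>. The value of \<open>h\<close> and the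
  gradient offset at \<open>x\<close> cancel, so the divergences reduce to \<open>\<phi>\<close> on the segment.
\<close>
lemma mirror_step_objective_on_segment:
  fixes x p z :: "'a::finite pmf"
  assumes step: "mirror_step c x p"
    and t: "0 \<le> t" "t \<le> 1"
  defines "q \<equiv> \<lambda>a. pmf p a + t * (pmf z a - pmf p a)"
  shows "(\<Sum>a\<in>UNIV. (c a + g (pmf x a)) * (t * (pmf z a - pmf p a)) - \<phi> (q a) + \<phi> (pmf p a)) \<le> 0"
proof -
  have q: "q a = (1 - t) * pmf p a + t * pmf z a" for a
    by (simp add: q_def algebra_simps)
  have "0 \<le> q a" for a
    using t by (simp add: q)
  moreover have "(\<Sum>a\<in>UNIV. q a) = 1"
    by (simp add: q sum.distrib sum_pmf_eq_1 flip: sum_distrib_left)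
  ultimately obtain m where m: "\<And>a. pmf m a = q a"
    using pmf_of_simplex_point by blast
  have "(\<Sum>a\<in>UNIV. c a * pmf m a) - D m x \<le> (\<Sum>a\<in>UNIV. c a * pmf p a) - D p x"
    using step by (simp add: mirror_step_def)
  moreover have "(\<Sum>a\<in>UNIV. c a * pmf m a) - D m x - ((\<Sum>a\<in>UNIV. c a * pmf p a) - D p x)
      = (\<Sum>a\<in>UNIV. (c a + g (pmf x a)) * (t * (pmf z a - pmf p a)) - \<phi> (q a) + \<phi> (pmf p a))"
    unfolding D_def m sum_subtractf[symmetric] by (intro sum.cong) (auto simp: q_def algebra_simps)
  ultimately show ?thesis by simp
qed

text \<open>
  Steepness keeps the iterates in the interior. Along points \<open>q\<close> of the segment from \<open>p\<close> to \<open>x\<close>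
  that tend to \<open>p\<close>, optimality bounds \<open>\<Sum>\<^sub>b (g(x\<^sub>b) - g(q\<^sub>b))(x\<^sub>b - p\<^sub>b)\<close> from above. Monotonicity of
  \<open>g\<close> makes every summand nonnegative, so each one is bounded on its own, and so is the gradient at
  each coordinate that moves. A boundary coordinate of \<open>p\<close> would contradict this.
\<close>
lemma mirror_step_interior:
  assumes step: "mirror_step c x p" and x: "\<And>a. pmf x a \<in> interior dom\<^sub>\<psi>"
  shows "pmf p a \<in> interior dom\<^sub>\<psi>"
proof (rule ccontr)
  assume boundary: "pmf p a \<notin> interior dom\<^sub>\<psi>"
  define d where "d b = pmf x b - pmf p b" for b
  define t :: "nat \<Rightarrow> real" where "t n = inverse (real (Suc n))" for n
  define q where "q n b = pmf p b + t n * d b" for n b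
  define K where "K = (\<Sum>b\<in>UNIV. - c b * d b)"
  have t: "0 < t n" "t n \<le> 1" for n
    by (simp_all add: t_def inverse_le_1_iff)
  have q: "q n b \<in> interior dom\<^sub>\<psi>" for n b
    unfolding q_def d_def by (intro shrink_interior pmf_dom x t)
  have bound: "\<bar>g (pmf x a) - g (q n a)\<bar> * \<bar>d a\<bar> \<le> K" for n
  proof -
    \<comment> \<open>The tangent at the interior point \<open>q n b\<close> replaces \<open>\<phi>\<close>, which may have no derivative at \<open>pmf p b\<close>.\<close>
    have "(c b + g (pmf x b)) * (t n * d b) - g (q n b) * (t n * d b)
        \<le> (c b + g (pmf x b)) * (t n * d b) - \<phi> (q n b) + \<phi> (pmf p b)" for b
      using tangent_le[OF q pmf_dom, of n b p b] by (simp add: q_def)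
    then have "(\<Sum>b\<in>UNIV. (c b + g (pmf x b)) * (t n * d b) - g (q n b) * (t n * d b))
        \<le> (\<Sum>b\<in>UNIV. (c b + g (pmf x b)) * (t n * d b) - \<phi> (q n b) + \<phi> (pmf p b))"
      by (rule sum_mono)
    also have "\<dots> \<le> 0"
      using mirror_step_objective_on_segment[OF step, of "t n" x] t[of n] by (simp add: q_def d_def)
    finally have "t n * ((\<Sum>b\<in>UNIV. (g (pmf x b) - g (q n b)) * d b) - K) \<le> 0"
      by (simp add: K_def sum_distrib_left sum_subtractf sum_negf sum.distrib algebra_simps)
    then have "(\<Sum>b\<in>UNIV. (g (pmf x b) - g (q n b)) * d b) \<le> K"
      using t[of n] by (simp add: mult_le_0_iff)
    moreover have nonneg: "0 \<le> (g (pmf x b) - g (q n b)) * d b" for b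
    proof (cases "t n = 1")
      case True
      then show ?thesis by (simp add: q_def d_def)
    next
      case False
      have "0 \<le> (g (pmf x b) - g (q n b)) * (pmf x b - q n b)"
        by (rule g_monotone(2)[OF q x])
      also have "pmf x b - q n b = (1 - t n) * d b"
        by (simp add: q_def d_def algebra_simps)
      finally have "0 \<le> (1 - t n) * ((g (pmf x b) - g (q n b)) * d b)"
        by (simp only: mult.left_commute)
      moreover have "0 < 1 - t n"
        using t(2)[of n] False by simp
      ultimately show ?thesis
        by (meson mult_pos_neg not_le)
    qed
    moreover have "(g (pmf x a) - g (q n a)) * d a \<le> (\<Sum>b\<in>UNIV. (g (pmf x b) - g (q n b)) * d b)"
      using nonneg by (intro member_le_sum) auto
    ultimately show ?thesis
      using nonneg[of a] by (simp flip: abs_mult)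
  qed
  have "d a \<noteq> 0"
    using boundary x[of a] by (auto simp: d_def)
  then have "\<bar>g (q n a)\<bar> \<le> \<bar>g (pmf x a)\<bar> + K / \<bar>d a\<bar>" for n
    using bound[of n] by (simp add: pos_le_divide_eq[symmetric])
  then have g_bound: "\<forall>\<^sub>F n in sequentially. \<bar>g (q n a)\<bar> \<le> \<bar>g (pmf x a)\<bar> + K / \<bar>d a\<bar>"
    by simp
  have "(\<lambda>n. q n a) \<longlonglongrightarrow> pmf p a + 0 * d a"
    unfolding q_def t_def by (intro tendsto_intros LIMSEQ_inverse_real_of_nat)
  then have "(\<lambda>n. q n a) \<longlonglongrightarrow> pmf p a"
    by simp
  from g_unbounded_near_frontier[OF q this pmf_dom boundary g_bound] show False .
qed

text \<open>
  The first-order condition: at an interior maximiser the derivative of the objective in a direction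
  that points into the simplex is nonpositive.
\<close>
lemma mirror_step_variational:
  assumes step: "mirror_step c x p" and p: "\<And>a. pmf p a \<in> interior dom\<^sub>\<psi>"
  shows "(\<Sum>a\<in>UNIV. (c a + g (pmf x a) - g (pmf p a)) * (pmf z a - pmf p a)) \<le> 0" (is "?l \<le> 0")
proof (rule ccontr)
  assume "\<not> ?l \<le> 0"
  let ?d = "\<lambda>a. pmf z a - pmf p a"
  let ?F = "\<lambda>t. \<Sum>a\<in>UNIV. (c a + g (pmf x a)) * (t * ?d a) - \<phi> (pmf p a + t * ?d a) + \<phi> (pmf p a)"
  have "((\<lambda>t. \<phi> (pmf p a + t * ?d a)) has_real_derivative g (pmf p a) * ?d a) (at 0)" for a
    by (rule DERIV_chain2[of \<phi>]) (auto intro!: derivative_eq_intros DERIV_\<phi> p)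
  then have "(?F has_real_derivative ?l) (at 0)"
    by (intro DERIV_sum) (auto intro!: derivative_eq_intros simp: algebra_simps)
  from DERIV_pos_inc_right[OF this] \<open>\<not> ?l \<le> 0\<close>
  obtain \<delta> where \<delta>: "0 < \<delta>" "\<And>h. 0 < h \<Longrightarrow> h < \<delta> \<Longrightarrow> ?F 0 < ?F (0 + h)"
    by auto
  define h where "h = min (\<delta> / 2) 1"
  have h: "0 < h" "h < \<delta>" "h \<le> 1"
    using \<delta>(1) by (auto simp: h_def)
  have "?F h \<le> 0"
    using mirror_step_objective_on_segment[OF step, of h z] h by simp
  with \<delta>(2)[OF h(1,2)] show False
    by simp
qed

text \<open>
  The three-point inequality of Bregman proximal steps, with the nonnegative divergence
  \<open>D p x\<close> dropped: the difference of the divergences is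
  \<open>\<Sum>\<^sub>a (g(x\<^sub>a) - g(p\<^sub>a))(z\<^sub>a - p\<^sub>a) - D p x\<close>, and the first-order condition bounds the sum.
\<close>
lemma mirror_step_divergence_le:
  assumes step: "mirror_step c x p" and x: "\<And>a. pmf x a \<in> interior dom\<^sub>\<psi>"
  shows "D z p \<le> D z x + (\<Sum>a\<in>UNIV. c a * pmf p a) - (\<Sum>a\<in>UNIV. c a * pmf z a)"
proof -
  note p = mirror_step_interior[OF step x]
  have "D z p - D z x \<le> (\<Sum>a\<in>UNIV. (g (pmf x a) - g (pmf p a)) * (pmf z a - pmf p a))"
    unfolding D_def sum_subtractf[symmetric]
  proof (rule sum_mono)
    fix a
    show "\<phi> (pmf z a) - \<phi> (pmf p a) - g (pmf p a) * (pmf z a - pmf p a)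
        - (\<phi> (pmf z a) - \<phi> (pmf x a) - g (pmf x a) * (pmf z a - pmf x a))
        \<le> (g (pmf x a) - g (pmf p a)) * (pmf z a - pmf p a)"
      using tangent_le[OF x pmf_dom, of a p a] by (simp add: algebra_simps)
  qed
  also have "\<dots> \<le> - (\<Sum>a\<in>UNIV. c a * (pmf z a - pmf p a))"
    using mirror_step_variational[OF step p, of z]
    by (simp add: algebra_simps sum.distrib sum_subtractf)
  finally show ?thesis
    by (simp add: right_diff_distrib sum_subtractf)
qed

section \<open>Convergence of mirror descent iterates\<close>

text \<open>
  Here \<open>v\<close> is the optimal value of the state and \<open>A\<close> its optimal actions. Whatever the next iterate,
  its average of \<open>q k\<close> is at most \<open>v\<close>, and the point mass at an optimal action falls short of \<open>v\<close>
  by at most \<open>e k\<close>; so the divergence from that point mass is almost decreasing.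
\<close>
lemma mirror_gradient_difference_converges:
  fixes x :: "nat \<Rightarrow> 'a::finite pmf"
  assumes x: "\<And>k a. pmf (x k) a \<in> interior dom\<^sub>\<psi>"
    and step: "\<And>k. mirror_step (\<lambda>a. \<eta> * q k a) (x k) (x (Suc k))"
    and \<eta>: "0 \<le> \<eta>" and q: "\<And>k a. q k a \<le> v" and e: "summable e"
    and near: "\<And>k a. a \<in> A \<Longrightarrow> v - q k a \<le> e k"
    and ab: "a \<in> A" "b \<in> A"
  shows "convergent (\<lambda>k. g (pmf (x k) a) - g (pmf (x k) b))"
proof -
  have e0: "0 \<le> e k" for k
    using q[of k a] near[OF ab(1), of k] by simp
  have "convergent (\<lambda>k. D (return_pmf c) (x k))" if c: "c \<in> A" for c
  proof (rule convergent_if_summable_increase)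
    show "D (return_pmf c) (x (Suc k)) \<le> D (return_pmf c) (x k) + \<eta> * e k" for k
    proof -
      have "(\<Sum>a\<in>UNIV. \<eta> * q k a * pmf (x (Suc k)) a)
          = \<eta> * (\<Sum>a\<in>UNIV. pmf (x (Suc k)) a * q k a)"
        by (simp add: sum_distrib_left mult_ac)
      also have "\<dots> \<le> \<eta> * v"
        using q \<eta> by (intro mult_left_mono average_le)
      also have "\<dots> \<le> \<eta> * (q k c + e k)"
        using near[OF c, of k] \<eta> by (intro mult_left_mono) auto
      finally have "(\<Sum>a\<in>UNIV. \<eta> * q k a * pmf (x (Suc k)) a) \<le> \<eta> * q k c + \<eta> * e k"
        by (simp add: distrib_left)
      moreover have "(\<Sum>a\<in>UNIV. \<eta> * q k a * pmf (return_pmf c) a) = \<eta> * q k c"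
        using expectation_finite_type[of "return_pmf c" "\<lambda>a. \<eta> * q k a"] by (simp add: mult.commute)
      ultimately show ?thesis
        using mirror_step_divergence_le[OF step x, of "return_pmf c" k] by simp
    qed
    show "0 \<le> D (return_pmf c) (x k)" for k
      by (intro D_nonneg x)
  qed (use \<eta> e0 e in \<open>auto intro: summable_mult\<close>)
  from convergent_diff[OF this[OF ab(2)] this[OF ab(1)]] show ?thesis
    by (simp add: D_vertex_diff)
qed

text \<open>
  Only values of \<open>g\<close> at points strictly between two cluster points are compared. These lie in the open
  unit interval, hence in the interior of the domain, even when a cluster point is on its boundary.
\<close>
lemma convergent_if_gradient_differences_converge:
  fixes x :: "nat \<Rightarrow> 'a::finite pmf"
  assumes x: "\<And>k a. pmf (x k) a \<in> interior dom\<^sub>\<psi>"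
    and vanish: "\<And>a. a \<notin> A \<Longrightarrow> (\<lambda>k. pmf (x k) a) \<longlonglongrightarrow> 0"
    and conv: "\<And>a b. a \<in> A \<Longrightarrow> b \<in> A \<Longrightarrow> convergent (\<lambda>k. g (pmf (x k) a) - g (pmf (x k) b))"
  obtains p where "\<And>a. (\<lambda>k. pmf (x k) a) \<longlonglongrightarrow> pmf p a"
proof -
  have cluster: "0 \<le> y $ a" "y $ a \<le> 1" "(\<Sum>a\<in>UNIV. y $ a) = 1" "a \<notin> A \<Longrightarrow> y $ a = 0"
      "(\<lambda>k. pmf (x (\<rho> k)) a) \<longlonglongrightarrow> y $ a"
    if \<rho>: "strict_mono \<rho>" "((\<lambda>k. pmf_vec (x k)) \<circ> \<rho>) \<longlonglongrightarrow> y" for \<rho> y and a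
  proof -
    have lim: "(\<lambda>k. pmf (x (\<rho> k)) a) \<longlonglongrightarrow> y $ a" for a
      using tendsto_vec_nth[OF \<rho>(2), of a] by (simp add: pmf_vec_def)
    show "(\<lambda>k. pmf (x (\<rho> k)) a) \<longlonglongrightarrow> y $ a"
      by (fact lim)
    show "0 \<le> y $ a"
      by (rule LIMSEQ_le_const[OF lim]) simp
    show "y $ a \<le> 1"
      by (rule LIMSEQ_le_const2[OF lim]) (simp add: pmf_le_1)
    have "(\<lambda>k. \<Sum>a\<in>UNIV. pmf (x (\<rho> k)) a) \<longlonglongrightarrow> (\<Sum>a\<in>UNIV. y $ a)"
      by (intro tendsto_sum lim)
    then show "(\<Sum>a\<in>UNIV. y $ a) = 1"
      by (simp add: sum_pmf_eq_1 LIMSEQ_const_iff)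
    show "y $ a = 0" if "a \<notin> A"
      using LIMSEQ_unique[OF lim LIMSEQ_subseq_LIMSEQ[OF vanish[OF that] \<rho>(1), unfolded comp_def]] .
  qed
  \<comment> \<open>A vector that carries all its mass on \<open>A\<close> exceeds any other nonnegative vector of equal
    mass somewhere on \<open>A\<close>.\<close>
  have smaller: "\<exists>a\<in>A. y $ a < z $ a"
    if "\<And>a. a \<notin> A \<Longrightarrow> z $ a = 0" "\<And>a. 0 \<le> y $ a" "(\<Sum>a\<in>UNIV. y $ a) = (\<Sum>a\<in>UNIV. z $ a)" "y \<noteq> z"
    for y z :: "real ^ 'a"
  proof (rule ccontr)
    assume "\<not> ?thesis"
    then have le: "z $ a \<le> y $ a" for a
      using that(1,2) by (cases "a \<in> A") (auto simp: not_less)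
    have "y $ a = z $ a" for a
    proof -
      have "(\<Sum>a\<in>UNIV. y $ a - z $ a) = 0"
        using that(3) by (simp add: sum_subtractf)
      then show ?thesis
        using le by (subst (asm) sum_nonneg_eq_0_iff) auto
    qed
    with \<open>y \<noteq> z\<close> show False
      by (simp add: vec_eq_iff)
  qed
  \<comment> \<open>Two levels in the open unit interval separate the limits \<open>l\<close> and \<open>l'\<close>, and \<open>g\<close> keeps them apart.\<close>
  have gap: "\<exists>s t. s < t \<and> (\<forall>\<^sub>F k in sequentially. g (pmf (x (\<rho> k)) a) \<le> s)
      \<and> (\<forall>\<^sub>F k in sequentially. t \<le> g (pmf (x (\<sigma> k)) a))"
    if lim: "(\<lambda>k. pmf (x (\<rho> k)) a) \<longlonglongrightarrow> l" "(\<lambda>k. pmf (x (\<sigma> k)) a) \<longlonglongrightarrow> l'"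
      and l: "0 \<le> l" "l < l'" "l' \<le> 1" for \<rho> \<sigma> :: "nat \<Rightarrow> nat" and a l l'
  proof -
    obtain u where u: "l < u" "u < l'"
      using dense l(2) by blast
    obtain w where w: "u < w" "w < l'"
      using dense u(2) by blast
    have int: "u \<in> interior dom\<^sub>\<psi>" "w \<in> interior dom\<^sub>\<psi>"
      using u w l by (auto intro: open_unit_interval_interior)
    have "\<forall>\<^sub>F k in sequentially. pmf (x (\<rho> k)) a < u"
      by (rule order_tendstoD(2)[OF lim(1) u(1)])
    then have "\<forall>\<^sub>F k in sequentially. g (pmf (x (\<rho> k)) a) \<le> g u"
      by eventually_elim (simp add: g_monotone(1) x int)
    moreover have "\<forall>\<^sub>F k in sequentially. w < pmf (x (\<sigma> k)) a"
      by (rule order_tendstoD(1)[OF lim(2) w(2)])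
    then have "\<forall>\<^sub>F k in sequentially. g w \<le> g (pmf (x (\<sigma> k)) a)"
      by eventually_elim (simp add: g_monotone(1) x int)
    ultimately show ?thesis
      using g_strict_mono[OF int w(1)] by blast
  qed
  have "convergent (\<lambda>k. pmf_vec (x k))"
  proof (rule convergent_if_unique_cluster_point)
    show "compact (cbox 0 1 :: (real ^ 'a) set)"
      by (rule compact_cbox)
    show "pmf_vec (x k) \<in> cbox 0 1" for k
      by (simp add: mem_box_cart pmf_vec_def pmf_le_1)
    fix \<rho> \<sigma> y z
    assume \<rho>: "strict_mono \<rho>" "((\<lambda>k. pmf_vec (x k)) \<circ> \<rho>) \<longlonglongrightarrow> y"
      and \<sigma>: "strict_mono \<sigma>" "((\<lambda>k. pmf_vec (x k)) \<circ> \<sigma>) \<longlonglongrightarrow> z"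
    show "y = z"
    proof (rule ccontr)
      assume "y \<noteq> z"
      obtain a where a: "a \<in> A" "y $ a < z $ a"
        using smaller[of z y] cluster[OF \<rho>] cluster[OF \<sigma>] \<open>y \<noteq> z\<close> by auto
      obtain b where b: "b \<in> A" "z $ b < y $ b"
        using smaller[of y z] cluster[OF \<rho>] cluster[OF \<sigma>] \<open>y \<noteq> z\<close> by auto
      obtain s t where st: "s < t" "\<forall>\<^sub>F k in sequentially. g (pmf (x (\<rho> k)) a) \<le> s"
          "\<forall>\<^sub>F k in sequentially. t \<le> g (pmf (x (\<sigma> k)) a)"
        using gap[OF cluster(5)[OF \<rho>] cluster(5)[OF \<sigma>] cluster(1)[OF \<rho>] a(2) cluster(2)[OF \<sigma>]] by blast
      obtain s' t' where st': "s' < t'" "\<forall>\<^sub>F k in sequentially. g (pmf (x (\<sigma> k)) b) \<le> s'"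
          "\<forall>\<^sub>F k in sequentially. t' \<le> g (pmf (x (\<rho> k)) b)"
        using gap[OF cluster(5)[OF \<sigma>] cluster(5)[OF \<rho>] cluster(1)[OF \<sigma>] b(2) cluster(2)[OF \<rho>]] by blast
      obtain l where l: "(\<lambda>k. g (pmf (x k) a) - g (pmf (x k) b)) \<longlonglongrightarrow> l"
        using conv[OF a(1) b(1)] by (auto simp: convergent_def)
      have "l \<le> s - t'"
      proof (rule tendsto_upperbound[OF LIMSEQ_subseq_LIMSEQ[OF l \<rho>(1)]])
        show "\<forall>\<^sub>F k in sequentially. ((\<lambda>k. g (pmf (x k) a) - g (pmf (x k) b)) \<circ> \<rho>) k \<le> s - t'"
          using st(2) st'(3) by eventually_elim simp
      qed simp
      moreover have "t - s' \<le> l"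
      proof (rule tendsto_lowerbound[OF LIMSEQ_subseq_LIMSEQ[OF l \<sigma>(1)]])
        show "\<forall>\<^sub>F k in sequentially. t - s' \<le> ((\<lambda>k. g (pmf (x k) a) - g (pmf (x k) b)) \<circ> \<sigma>) k"
          using st(3) st'(2) by eventually_elim simp
      qed simp
      ultimately show False
        using st(1) st'(1) by simp
    qed
  qed
  then obtain y where y: "(\<lambda>k. pmf_vec (x k)) \<longlonglongrightarrow> y"
    by (auto simp: convergent_def)
  note y' = cluster[OF strict_mono_id, unfolded comp_id id_apply, OF y]
  obtain p where "\<And>a. pmf p a = y $ a"
    using pmf_of_simplex_point[of "\<lambda>a. y $ a"] y'(1,3) by blast
  with y'(5) show thesis
    by (intro that[of p]) simp
qed

text \<open>
  A boundary coordinate in the limit must be \<open>0\<close> or \<open>1\<close>. Monotonicity of \<open>g\<close> bounds its gradient on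
  one side. On the other side the bound comes from a second optimal action \<open>b\<close>: if the limit is
  \<open>0\<close>, some \<open>b\<close> retains positive mass and its gradient is bounded below; if the limit is \<open>1\<close>, any
  other \<open>b\<close> loses all mass and its gradient is bounded above. Convergence of the gradient
  differences transfers the bound, which contradicts steepness.
\<close>
lemma limit_interior_if_gradient_differences_converge:
  fixes x :: "nat \<Rightarrow> 'a::finite pmf"
  assumes x: "\<And>k a. pmf (x k) a \<in> interior dom\<^sub>\<psi>"
    and lim: "\<And>a. (\<lambda>k. pmf (x k) a) \<longlonglongrightarrow> pmf p a"
    and supp: "\<And>a. a \<notin> A \<Longrightarrow> pmf p a = 0"
    and conv: "\<And>a b. a \<in> A \<Longrightarrow> b \<in> A \<Longrightarrow> convergent (\<lambda>k. g (pmf (x k) a) - g (pmf (x k) b))"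
    and A: "1 < card A" and a: "a \<in> A"
  shows "pmf p a \<in> interior dom\<^sub>\<psi>"
proof (rule ccontr)
  assume boundary: "pmf p a \<notin> interior dom\<^sub>\<psi>"
  have half: "1/2 \<in> interior dom\<^sub>\<psi>"
    by (simp add: open_unit_interval_interior)
  have diff_bounded: "\<exists>B. \<forall>k. \<bar>g (pmf (x k) a) - g (pmf (x k) b)\<bar> \<le> B" if "b \<in> A" for b
    using convergent_imp_Bseq[OF conv[OF a that]] by (auto simp: Bseq_def)
  have mass: "(\<Sum>b\<in>UNIV. pmf p b) = 1"
    by (simp add: sum_pmf_eq_1)
  have "pmf p a = 0 \<or> pmf p a = 1"
    using boundary open_unit_interval_interior[of "pmf p a"] pmf_nonneg[of p a] pmf_le_1[of p a] by linarith
  then obtain lo hi where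
    "\<forall>\<^sub>F k in sequentially. lo \<le> g (pmf (x k) a) \<and> g (pmf (x k) a) \<le> hi"
  proof
    assume p0: "pmf p a = 0"
    obtain b where b: "0 < pmf p b"
      using mass pmf_nonneg[of p] by (metis less_eq_real_def sum.neutral zero_neq_one)
    with supp have "b \<in> A" by force
    then obtain B where B: "\<And>k. \<bar>g (pmf (x k) a) - g (pmf (x k) b)\<bar> \<le> B"
      using diff_bounded by blast
    have \<delta>: "pmf p b / 2 \<in> interior dom\<^sub>\<psi>"
      using b pmf_le_1[of p b] by (intro open_unit_interval_interior) auto
    have "\<forall>\<^sub>F k in sequentially. pmf p b / 2 < pmf (x k) b"
      using b by (intro order_tendstoD(1)[OF lim]) simp
    moreover have "\<forall>\<^sub>F k in sequentially. pmf (x k) a < 1/2"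
      using p0 by (intro order_tendstoD(2)[OF lim]) simp
    ultimately have "\<forall>\<^sub>F k in sequentially.
        g (pmf p b / 2) - B \<le> g (pmf (x k) a) \<and> g (pmf (x k) a) \<le> g (1/2)"
    proof eventually_elim
      case (elim k)
      show ?case
        using g_monotone(1)[OF \<delta> x, of k b] g_monotone(1)[OF x half, of k a] elim B[of k]
        by (auto simp: abs_le_iff)
    qed
    then show thesis
      by (rule that)
  next
    assume p1: "pmf p a = 1"
    have "A \<noteq> {a}"
      using A by auto
    with a obtain b where b: "b \<in> A" "b \<noteq> a"
      by auto
    then obtain B where B: "\<And>k. \<bar>g (pmf (x k) a) - g (pmf (x k) b)\<bar> \<le> B"
      using diff_bounded by blast
    have "pmf p a + pmf p b \<le> (\<Sum>b\<in>UNIV. pmf p b)"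
      using sum_mono2[of UNIV "{a, b}" "pmf p"] b by simp
    with p1 mass have p0: "pmf p b = 0"
      using pmf_nonneg[of p b] by simp
    have "\<forall>\<^sub>F k in sequentially. 1/2 < pmf (x k) a"
      using p1 by (intro order_tendstoD(1)[OF lim]) simp
    moreover have "\<forall>\<^sub>F k in sequentially. pmf (x k) b < 1/2"
      using p0 by (intro order_tendstoD(2)[OF lim]) simp
    ultimately have "\<forall>\<^sub>F k in sequentially.
        g (1/2) \<le> g (pmf (x k) a) \<and> g (pmf (x k) a) \<le> g (1/2) + B"
    proof eventually_elim
      case (elim k)
      show ?case
        using g_monotone(1)[OF half x, of k a] g_monotone(1)[OF x half, of k b] elim B[of k]
        by (auto simp: abs_le_iff)
    qed
    then show thesis
      by (rule that)
  qed
  then have "\<forall>\<^sub>F k in sequentially. \<bar>g (pmf (x k) a)\<bar> \<le> max \<bar>lo\<bar> \<bar>hi\<bar>"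
    by eventually_elim auto
  then show False
    by (rule g_unbounded_near_frontier[OF x lim pmf_dom boundary])
qed

end

section \<open>Convergence of policy mirror descent\<close>

theorem lemma3p1:
  fixes P :: "('s::finite, 'a::finite) transition"
    and r :: "'s \<Rightarrow> 'a \<Rightarrow> real"
    and \<gamma> \<eta> :: real
    and \<psi> :: "real \<Rightarrow> ereal"
    and \<pi> :: "nat \<Rightarrow> ('s, 'a) policy"
  assumes "\<And>s a. r s a \<in> {0..1}"
    and "0 \<le> \<gamma>" and "\<gamma> < 1"
    and "S_tilde P r \<gamma> \<noteq> {}"
    and "mirror_map \<psi>"
    and "\<eta> > 0"
    and "is_PMD P r \<gamma> \<psi> \<eta> \<pi>"
    and "summable (\<lambda>k. infnorm (\<chi> s. V_star P r \<gamma> s - V_val P r \<gamma> (\<pi> k) s))"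
  shows "\<exists>\<pi>_inf. (\<forall>s. (\<lambda>k. pmf_vec (\<pi> k s)) \<longlonglongrightarrow> pmf_vec (\<pi>_inf s)) \<and>
           \<pi>_inf \<in> optimal_policies P r \<gamma> \<and>
           (\<forall>s. \<forall>a'. a' \<notin> optimal_actions P r \<gamma> s \<longrightarrow> pmf (\<pi>_inf s) a' = 0) \<and>
           (\<forall>s \<in> S_eq1 P r \<gamma>. \<forall>a \<in> optimal_actions P r \<gamma> s. pmf (\<pi>_inf s) a = 1) \<and>
           (\<forall>s \<in> S_gt1 P r \<gamma>. \<forall>a \<in> optimal_actions P r \<gamma> s.
              pmf (\<pi>_inf s) a \<in> interior (eff_dom \<psi>))"
proof -
  interpret discounted_mdp P r \<gamma>
    by unfold_locales (use assms(1-3) in auto)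
  interpret separable_mirror_map \<psi>
    by unfold_locales (rule assms(5))
  let ?e = "\<lambda>k. infnorm (\<chi> s. V\<^sub>o\<^sub>p\<^sub>t s - V (\<pi> k) s)"
  have V_close: "V\<^sub>o\<^sub>p\<^sub>t s - V (\<pi> k) s \<le> ?e k" for k s
    using component_le_infnorm_cart[of "\<chi> s. V\<^sub>o\<^sub>p\<^sub>t s - V (\<pi> k) s" s] by simp
  have e_lim: "?e \<longlonglongrightarrow> 0"
    using assms(8) by (rule summable_LIMSEQ_zero)
  have V_lim: "(\<lambda>k. V (\<pi> k) s) \<longlonglongrightarrow> V\<^sub>o\<^sub>p\<^sub>t s" for s
  proof (rule tendsto_sandwich)
    show "(\<lambda>k. V\<^sub>o\<^sub>p\<^sub>t s - ?e k) \<longlonglongrightarrow> V\<^sub>o\<^sub>p\<^sub>t s"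
      using tendsto_diff[OF tendsto_const e_lim] by simp
    show "\<forall>\<^sub>F k in sequentially. V\<^sub>o\<^sub>p\<^sub>t s - ?e k \<le> V (\<pi> k) s"
      using V_close by (simp add: algebra_simps)
  qed (auto simp: V_le_V_star)
  have step_if_interior: "mirror_step (\<lambda>a. \<eta> * Q (\<pi> k) s a) (\<pi> k s) (\<pi> (Suc k) s)"
    if "\<And>a. pmf (\<pi> k s) a \<in> interior dom\<^sub>\<psi>" for k s
  proof -
    have lin: "\<eta> * (pmf_vec p \<bullet> vec_lambda (Q (\<pi> k) s)) = (\<Sum>a\<in>UNIV. \<eta> * Q (\<pi> k) s a * pmf p a)" for p
      by (simp add: pmf_vec_def inner_vec_def sum_distrib_left mult_ac)
    have "is_arg_max (\<lambda>p. ereal (\<eta> * (pmf_vec p \<bullet> vec_lambda (Q (\<pi> k) s)))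
        - bregman \<psi> (pmf_vec p) (pmf_vec (\<pi> k s))) (\<lambda>_. True) (\<pi> (Suc k) s)"
      using assms(7) by (simp add: is_PMD_def)
    then show ?thesis
      by (simp add: is_arg_max_def lin bregman_eq_D[OF that] mirror_step_def not_less)
  qed
  \<comment> \<open>The PMD objective has its real-valued form only if the current iterate is interior, so
    this must be propagated step by step.\<close>
  have interior: "pmf (\<pi> k s) a \<in> interior dom\<^sub>\<psi>" for k s a
  proof (induction k arbitrary: s a)
    case 0
    show ?case
      using assms(7) by (simp add: is_PMD_def)
  next
    case (Suc k)
    show ?case
      by (rule mirror_step_interior[OF step_if_interior[OF Suc.IH] Suc.IH])
  qed
  have gradients: "convergent (\<lambda>k. g (pmf (\<pi> k s) a) - g (pmf (\<pi> k s) b))"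
    if "a \<in> \<A> s" "b \<in> \<A> s" for s a b
  proof (rule mirror_gradient_difference_converges[where x="\<lambda>k. \<pi> k s" and q="\<lambda>k. Q (\<pi> k) s" and A="\<A> s",
        OF interior step_if_interior[OF interior] _ Q_le_V_star assms(8) _ that])
    show "V\<^sub>o\<^sub>p\<^sub>t s - Q (\<pi> k) s a \<le> ?e k" if "a \<in> \<A> s" for k a
      using that Q_star_minus_Q_le[of s a "\<pi> k"] by (simp add: optimal_actions_def)
  qed (use assms(6) in simp)
  have vanish: "(\<lambda>k. pmf (\<pi> k s) a) \<longlonglongrightarrow> 0" if a: "a \<notin> \<A> s" for s a
  proof (rule tendsto_sandwich[where f="\<lambda>_. 0"])
    let ?gap = "\<lambda>b. V\<^sub>o\<^sub>p\<^sub>t s - Q\<^sub>o\<^sub>p\<^sub>t s b"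
    have gap: "0 < ?gap a"
      using Q_star_le_V_star[of s a] a by (auto simp: optimal_actions_def)
    have "pmf (\<pi> k s) a * ?gap a \<le> ?e k" for k
    proof -
      have "pmf (\<pi> k s) a * ?gap a \<le> (\<Sum>b\<in>UNIV. pmf (\<pi> k s) b * ?gap b)"
        by (rule member_le_sum[of a UNIV "\<lambda>b. pmf (\<pi> k s) b * ?gap b"])
          (auto intro: mult_nonneg_nonneg simp: Q_star_le_V_star)
      also note average_suboptimality_le
      also note V_close
      finally show ?thesis .
    qed
    then show "\<forall>\<^sub>F k in sequentially. pmf (\<pi> k s) a \<le> ?e k / ?gap a"
      using gap by (simp add: pos_le_divide_eq)
    show "(\<lambda>k. ?e k / ?gap a) \<longlonglongrightarrow> 0"
      using tendsto_divide[OF e_lim tendsto_const, of "?gap a"] gap by simp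
  qed auto
  have "\<exists>p. \<forall>a. (\<lambda>k. pmf (\<pi> k s) a) \<longlonglongrightarrow> pmf p a" for s
    using convergent_if_gradient_differences_converge[where x="\<lambda>k. \<pi> k s" and A="\<A> s",
        OF interior vanish gradients] by metis
  then obtain p where lim: "\<And>s a. (\<lambda>k. pmf (\<pi> k s) a) \<longlonglongrightarrow> pmf (p s) a"
    by metis
  have supp: "pmf (p s) a = 0" if "a \<notin> \<A> s" for s a
    using LIMSEQ_unique[OF lim vanish[OF that]] .
  have "pmf (p s) a = 1" if s: "s \<in> S_eq1 P r \<gamma>" and a: "a \<in> \<A> s" for s a
  proof -
    have "\<A> s = {a}"
      using s a by (auto simp: S_eq1_def card_1_singleton_iff)
    then have "(\<Sum>b\<in>UNIV. pmf (p s) b) = (\<Sum>b\<in>{a}. pmf (p s) b)"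
      using supp by (intro sum.mono_neutral_right) auto
    then show ?thesis
      by (simp add: sum_pmf_eq_1)
  qed
  moreover have "pmf (p s) a \<in> interior dom\<^sub>\<psi>" if "s \<in> S_gt1 P r \<gamma>" "a \<in> \<A> s" for s a
    using limit_interior_if_gradient_differences_converge[where x="\<lambda>k. \<pi> k s" and p="p s" and A="\<A> s",
        OF interior lim supp gradients] that
    by (simp add: S_gt1_def)
  moreover have "(\<lambda>k. pmf_vec (\<pi> k s)) \<longlonglongrightarrow> pmf_vec (p s)" for s
    unfolding pmf_vec_def by (intro tendsto_vec_lambda lim)
  moreover have "p \<in> optimal_policies P r \<gamma>"
    by (rule limit_of_asymptotically_optimal_policies[OF V_lim lim])
  ultimately show ?thesis
    using supp by blast
qed

end
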